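(* (i) For $j\geq 1$, let $({\mathcal H},\pi_{j})$ be a representation of ${\mathcal O}_{\infty}$ with a cyclic vector $\Omega$ satisfying $\pi_{j}(s_{j})\Omega=\Omega$. Then there exist a dense subspace ${\mathcal D}_{j}$ of ${\mathcal H}$ and an action $\eta_{j}$ of ${\mathcal B}$ on ${\mathcal D}_{j}$ such that $\eta_{j}({\mathcal B})\Omega={\mathcal D}_{j}$ and $$\eta_{j}(a_{n}a_{n}^{*})\Omega=j\Omega\qquad(n\geq 1).$$ In particular, $\eta_{1}$ is the Fock representation of ${\mathcal B}$ with the vacuum $\Omega$. (ii) Let $({\mathcal H},\pi_{12})$ be a representation of ${\mathcal O}_{\infty}$ with a cyclic vector $\Omega$ satisfying $\pi_{12}(s_{1}s_{2})\Omega=\Omega$. Then there exist two subspaces $V_{1}$ and $V_{2}$ of ${\mathcal H}$ and two actions $\eta_{12}$ and $\eta_{21}$ of ${\mathcal B}$ on $V_{1}$ and $V_{2}$, respectively, such that $V_{1}\oplus V_{2}$ is dense in ${\mathcal H}$, $V_{1}=\eta_{12}({\mathcal B})\Omega$, $V_{2}=\eta_{21}({\mathcal B})\Omega'$ for $\Omega'\equiv\pi_{12}(s_{2})\Omega$, and the following holds for all $n\geq 1$: $$\eta_{12}(a_{2n-1})\Omega=\eta_{21}(a_{2n})\Omega'=0,\qquad \eta_{12}(a_{2n}^{*}a_{2n})\Omega=\Omega,\qquad \eta_{21}(a_{2n-1}^{*}a_{2n-1})\Omega'=\Omega'.$$ (iii) Any two (distinct members) of the representations $\{\eta_{j},\eta_{12},\eta_{21}:j\geq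 1\}$ of ${\mathcal B}$ are not unitarily equivalent. (iv) All of the representations $\{\eta_{j},\eta_{12},\eta_{21}:j\geq 1\}$ of ${\mathcal B}$ are irreducible.
   Context: ${\mathcal O}_{\infty}$ is the Cuntz algebra, i.e. the unital C$^{*}$-algebra universally generated by $\{s_{n}:n\in{\mathbf N}\}$, ${\mathbf N}=\{1,2,3,\ldots\}$, satisfying $s_{i}^{*}s_{j}=\delta_{ij}I$ for $i,j\in{\mathbf N}$ and $\sum_{i=1}^{k}s_{i}s_{i}^{*}\leq I$ for every $k\in{\mathbf N}$. A cyclic vector of a representation $({\mathcal H},\pi)$ of ${\mathcal O}_{\infty}$ is a vector $\Omega$ with $\pi({\mathcal O}_{\infty})\Omega$ dense in ${\mathcal H}$. ${\mathcal B}$ is the (unital) $*$-algebra of bosons, generated by $\{a_{n}:n\in{\mathbf N}\}$ satisfying $a_{n}a_{m}^{*}-a_{m}^{*}a_{n}=\delta_{nm}I$ and $a_{n}a_{m}-a_{m}a_{n}=a_{n}^{*}a_{m}^{*}-a_{m}^{*}a_{n}^{*}=0$ for all $n,m\in{\mathbf N}$. An action (representation) $\pi$ of ${\mathcal B}$ on a subspace ${\mathcal D}$ that is dense in a complex Hilbert space ${\mathcal K}$ (here ${\mathcal K}$ is the closure of ${\mathcal D}$) is a unital $*$-homomorphism from ${\mathcal B}$ to the $*$-algebra $\{x\in{\rm End}_{{\mathbf C}}({\mathcal D}):x^{*}{\mathcal D}\subset{\mathcal D}\}$, where $x^{*}$ is the Hilbert space adjoint (restricted to ${\mathcal D}$).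 A cyclic vector of it is a vector $\Omega\in{\mathcal D}$ with $\pi({\mathcal B})\Omega={\mathcal D}$. The Fock representation of ${\mathcal B}$ with vacuum $\Omega$ is the representation with a cyclic vector $\Omega$ satisfying $\pi(a_{n})\Omega=0$ for all $n\in{\mathbf N}$. A representation of ${\mathcal B}$ on ${\mathcal D}\subset{\mathcal K}$ is irreducible if the commutant of $\pi({\mathcal B})$ in the bounded operators on ${\mathcal K}$ consists of the scalar multiples of $I$. Unitary equivalence means the existence of a unitary between the Hilbert spaces that maps one dense domain onto the other and intertwines the actions. *)

theory Defs
  imports "HOL-Analysis.Analysis"
begin

section \<open>Complex vector spaces, Hilbert spaces and star-algebras\<close>

class complex_vector = ab_group_add +
  fixes scaleC :: "complex \<Rightarrow> 'a \<Rightarrow> 'a"  (infixr \<open>*\<^sub>C\<close> 75)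
  assumes scaleC_add_right: "c *\<^sub>C (x + y) = c *\<^sub>C x + c *\<^sub>C y"
    and scaleC_add_left: "(c + d) *\<^sub>C x = c *\<^sub>C x + d *\<^sub>C x"
    and scaleC_scaleC: "c *\<^sub>C d *\<^sub>C x = (c * d) *\<^sub>C x"
    and scaleC_one: "1 *\<^sub>C x = x"

text \<open>A complex Hilbert space extends the real Hilbert space whose real inner product is the
  real part of the complex one; norm and topology are therefore those of the library.
  The complex inner product is antilinear in its first argument.\<close>

class complex_hilbert_space = complex_vector + real_inner + complete_space +
  fixes cinner :: "'a \<Rightarrow> 'a \<Rightarrow> complex"
  assumes scaleR_eq_scaleC_vec: "r *\<^sub>R x = complex_of_real r *\<^sub>C x"
    and inner_eq_Re_cinner: "inner x y = Re (cinner x y)"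
    and cinner_commute: "cinner x y = cnj (cinner y x)"
    and cinner_add_right: "cinner x (y + z) = cinner x y + cinner x z"
    and cinner_scaleC_right: "cinner x (c *\<^sub>C y) = c * cinner x y"

text \<open>Unital star-algebras over the complex numbers. The unit is not required to differ from
  zero.\<close>

class star_algebra = complex_vector + ring + monoid_mult +
  fixes star :: "'a \<Rightarrow> 'a"  (\<open>(_\<^sup>\<star>)\<close> [1000] 999)
  assumes mult_scaleC_left: "(c *\<^sub>C x) * y = c *\<^sub>C (x * y)"
    and mult_scaleC_right: "x * (c *\<^sub>C y) = c *\<^sub>C (x * y)"
    and star_add: "(x + y)\<^sup>\<star> = x\<^sup>\<star> + y\<^sup>\<star>"
    and star_scaleC: "(c *\<^sub>C x)\<^sup>\<star> = cnj c *\<^sub>C x\<^sup>\<star>"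
    and star_mult: "(x * y)\<^sup>\<star> = y\<^sup>\<star> * x\<^sup>\<star>"
    and star_star: "(x\<^sup>\<star>)\<^sup>\<star> = x"

text \<open>Unital C*-algebras (complete normed star-algebras satisfying the C*-identity).\<close>

class cstar_algebra = star_algebra + real_normed_algebra_1 + complete_space +
  assumes scaleR_eq_scaleC_alg: "r *\<^sub>R x = complex_of_real r *\<^sub>C x"
    and norm_scaleC_alg: "norm (c *\<^sub>C x) = cmod c * norm x"
    and cstar_identity: "norm (x\<^sup>\<star> * x) = (norm x)\<^sup>2"

definition unital_star_hom :: "('a::star_algebra \<Rightarrow> 'b::star_algebra) \<Rightarrow> bool" where
  "unital_star_hom \<phi> \<longleftrightarrow>
     (\<forall>x y. \<phi> (x + y) = \<phi> x + \<phi> y) \<and> (\<forall>c x. \<phi> (c *\<^sub>C x) = c *\<^sub>C \<phi> x) \<and>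
     (\<forall>x y. \<phi> (x * y) = \<phi> x * \<phi> y) \<and> (\<forall>x. \<phi> (x\<^sup>\<star>) = (\<phi> x)\<^sup>\<star>) \<and> \<phi> 1 = 1"

definition cstar_le :: "'a::cstar_algebra \<Rightarrow> 'a \<Rightarrow> bool" where
  "cstar_le x y \<longleftrightarrow> (\<exists>z. y - x = z\<^sup>\<star> * z)"

definition csubspace :: "'a::complex_vector set \<Rightarrow> bool" where
  "csubspace D \<longleftrightarrow> 0 \<in> D \<and> (\<forall>u\<in>D. \<forall>v\<in>D. u + v \<in> D) \<and> (\<forall>c. \<forall>u\<in>D. c *\<^sub>C u \<in> D)"

definition clinear_into :: "'a::complex_vector set \<Rightarrow> 'b::complex_vector set \<Rightarrow> ('a \<Rightarrow> 'b) \<Rightarrow> bool" where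
  "clinear_into D E f \<longleftrightarrow>
     (\<forall>u\<in>D. f u \<in> E) \<and> (\<forall>u\<in>D. \<forall>v\<in>D. f (u + v) = f u + f v) \<and>
     (\<forall>c. \<forall>u\<in>D. f (c *\<^sub>C u) = c *\<^sub>C f u)"

definition bounded_operator_on :: "'h::complex_hilbert_space set \<Rightarrow> ('h \<Rightarrow> 'h) \<Rightarrow> bool" where
  "bounded_operator_on K T \<longleftrightarrow> clinear_into K K T \<and> (\<exists>M. \<forall>u\<in>K. norm (T u) \<le> M * norm u)"

section \<open>The Cuntz algebra and its representations\<close>

text \<open>Generators are indexed by the positive natural numbers; the value at index 0 of a
  family is irrelevant.\<close>

definition cuntz_relations :: "(nat \<Rightarrow> 'a::cstar_algebra) \<Rightarrow> bool" where
  "cuntz_relations t \<longleftrightarrow>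
     (\<forall>i\<ge>1. \<forall>j\<ge>1. (t i)\<^sup>\<star> * t j = (if i = j then 1 else 0)) \<and>
     (\<forall>k\<ge>1. cstar_le (\<Sum>i=1..k. t i * (t i)\<^sup>\<star>) 1)"

inductive_set star_subalgebra_gen :: "(nat \<Rightarrow> 'a::star_algebra) \<Rightarrow> 'a set" for t where
  sg_one: "1 \<in> star_subalgebra_gen t"
| sg_gen: "n \<ge> 1 \<Longrightarrow> t n \<in> star_subalgebra_gen t"
| sg_add: "x \<in> star_subalgebra_gen t \<Longrightarrow> y \<in> star_subalgebra_gen t \<Longrightarrow> x + y \<in> star_subalgebra_gen t"
| sg_mult: "x \<in> star_subalgebra_gen t \<Longrightarrow> y \<in> star_subalgebra_gen t \<Longrightarrow> x * y \<in> star_subalgebra_gen t"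
| sg_scale: "x \<in> star_subalgebra_gen t \<Longrightarrow> c *\<^sub>C x \<in> star_subalgebra_gen t"
| sg_star: "x \<in> star_subalgebra_gen t \<Longrightarrow> x\<^sup>\<star> \<in> star_subalgebra_gen t"

text \<open>The ambient C*-algebra is universally generated by the family s subject to the Cuntz
  relations. HOL cannot quantify over types inside a formula, so the class of C*-algebras with
  respect to which universality is asserted is given by the type parameter 'c. The Cuntz algebra
  has the property for every choice of 'c, hence a theorem that assumes it for one unspecified 'c
  applies to the Cuntz algebra.\<close>

definition cuntz_O_infinity :: "(nat \<Rightarrow> 'o::cstar_algebra) \<Rightarrow> 'c::cstar_algebra itself \<Rightarrow> bool" where
  "cuntz_O_infinity s (_ :: 'c itself) \<longleftrightarrow>
     cuntz_relations s \<and> closure (star_subalgebra_gen s) = UNIV \<and>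
     (\<forall>t :: nat \<Rightarrow> 'c. cuntz_relations t \<longrightarrow>
        (\<exists>\<phi> :: 'o \<Rightarrow> 'c. unital_star_hom \<phi> \<and> (\<forall>n\<ge>1. \<phi> (s n) = t n)))"

text \<open>Unital star-homomorphisms into the bounded operators on the Hilbert space 'h.\<close>

definition cstar_representation ::
    "('o::cstar_algebra \<Rightarrow> 'h::complex_hilbert_space \<Rightarrow> 'h) \<Rightarrow> bool" where
  "cstar_representation \<pi> \<longleftrightarrow>
     (\<forall>x. bounded_operator_on UNIV (\<pi> x)) \<and>
     (\<forall>x y u. \<pi> (x + y) u = \<pi> x u + \<pi> y u) \<and> (\<forall>c x u. \<pi> (c *\<^sub>C x) u = c *\<^sub>C \<pi> x u) \<and>
     (\<forall>x y u. \<pi> (x * y) u = \<pi> x (\<pi> y u)) \<and> (\<forall>u. \<pi> 1 u = u) \<and>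
     (\<forall>x u v. cinner (\<pi> (x\<^sup>\<star>) u) v = cinner u (\<pi> x v))"

text \<open>The condition that the vector is nonzero only excludes the zero Hilbert space, where all
  representations coincide.\<close>

definition cyclic_vector :: "('o::cstar_algebra \<Rightarrow> 'h::complex_hilbert_space \<Rightarrow> 'h) \<Rightarrow> 'h \<Rightarrow> bool" where
  "cyclic_vector \<pi> \<Omega> \<longleftrightarrow> \<Omega> \<noteq> 0 \<and> closure (range (\<lambda>x. \<pi> x \<Omega>)) = UNIV"

section \<open>The star-algebra of bosons\<close>

text \<open>The universal unital star-algebra with the canonical commutation relations: formal terms
  in the generators modulo the least congruence that contains the axioms of unital star-algebras
  and the relations. The constructor \<open>BGen k\<close> stands for the generator with index k + 1.\<close>

datatype boson_term =
    BGen nat | BZero | BOne | BPlus boson_term boson_term | BTimes boson_term boson_term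
  | BScale complex boson_term | BStar boson_term

definition bcomm :: "boson_term \<Rightarrow> boson_term \<Rightarrow> boson_term" where
  "bcomm x y = BPlus (BTimes x y) (BScale (-1) (BTimes y x))"

inductive boson_eq :: "boson_term \<Rightarrow> boson_term \<Rightarrow> bool" where
  be_refl: "boson_eq x x"
| be_sym: "boson_eq x y \<Longrightarrow> boson_eq y x"
| be_trans: "boson_eq x y \<Longrightarrow> boson_eq y z \<Longrightarrow> boson_eq x z"
| be_plus: "boson_eq x x' \<Longrightarrow> boson_eq y y' \<Longrightarrow> boson_eq (BPlus x y) (BPlus x' y')"
| be_times: "boson_eq x x' \<Longrightarrow> boson_eq y y' \<Longrightarrow> boson_eq (BTimes x y) (BTimes x' y')"
| be_scale: "boson_eq x x' \<Longrightarrow> boson_eq (BScale c x) (BScale c x')"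
| be_star: "boson_eq x x' \<Longrightarrow> boson_eq (BStar x) (BStar x')"
| be_plus_assoc: "boson_eq (BPlus (BPlus x y) z) (BPlus x (BPlus y z))"
| be_plus_comm: "boson_eq (BPlus x y) (BPlus y x)"
| be_plus_zero: "boson_eq (BPlus BZero x) x"
| be_plus_inv: "boson_eq (BPlus (BScale (-1) x) x) BZero"
| be_scale_right: "boson_eq (BScale c (BPlus x y)) (BPlus (BScale c x) (BScale c y))"
| be_scale_left: "boson_eq (BScale (c + d) x) (BPlus (BScale c x) (BScale d x))"
| be_scale_scale: "boson_eq (BScale c (BScale d x)) (BScale (c * d) x)"
| be_scale_one: "boson_eq (BScale 1 x) x"
| be_times_assoc: "boson_eq (BTimes (BTimes x y) z) (BTimes x (BTimes y z))"
| be_one_left: "boson_eq (BTimes BOne x) x"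
| be_one_right: "boson_eq (BTimes x BOne) x"
| be_distrib_right: "boson_eq (BTimes (BPlus x y) z) (BPlus (BTimes x z) (BTimes y z))"
| be_distrib_left: "boson_eq (BTimes x (BPlus y z)) (BPlus (BTimes x y) (BTimes x z))"
| be_times_scale_left: "boson_eq (BTimes (BScale c x) y) (BScale c (BTimes x y))"
| be_times_scale_right: "boson_eq (BTimes x (BScale c y)) (BScale c (BTimes x y))"
| be_star_plus: "boson_eq (BStar (BPlus x y)) (BPlus (BStar x) (BStar y))"
| be_star_scale: "boson_eq (BStar (BScale c x)) (BScale (cnj c) (BStar x))"
| be_star_times: "boson_eq (BStar (BTimes x y)) (BTimes (BStar y) (BStar x))"
| be_star_star: "boson_eq (BStar (BStar x)) x"
| be_ccr: "boson_eq (bcomm (BGen k) (BStar (BGen l))) (if k = l then BOne else BZero)"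
| be_ann: "boson_eq (bcomm (BGen k) (BGen l)) BZero"
| be_cre: "boson_eq (bcomm (BStar (BGen k)) (BStar (BGen l))) BZero"

quotient_type boson = boson_term / boson_eq
  by (rule equivpI) (auto intro!: reflpI sympI transpI intro: be_refl be_sym be_trans)

instantiation boson :: star_algebra
begin

lift_definition zero_boson :: boson is BZero .
lift_definition one_boson :: boson is BOne .
lift_definition plus_boson :: "boson \<Rightarrow> boson \<Rightarrow> boson" is BPlus by (rule be_plus)
lift_definition times_boson :: "boson \<Rightarrow> boson \<Rightarrow> boson" is BTimes by (rule be_times)
lift_definition scaleC_boson :: "complex \<Rightarrow> boson \<Rightarrow> boson" is BScale by (rule be_scale)
lift_definition star_boson :: "boson \<Rightarrow> boson" is BStar by (rule be_star)
lift_definition uminus_boson :: "boson \<Rightarrow> boson" is "BScale (-1)" by (rule be_scale)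
lift_definition minus_boson :: "boson \<Rightarrow> boson \<Rightarrow> boson" is "\<lambda>x y. BPlus x (BScale (-1) y)"
  by (intro be_plus be_scale)

instance
  by standard
    (transfer, rule be_plus_assoc be_plus_comm be_plus_zero be_plus_inv be_refl
      be_scale_right be_scale_left be_scale_scale be_scale_one be_times_assoc be_one_left
      be_one_right be_distrib_left be_distrib_right be_times_scale_left be_times_scale_right
      be_star_plus be_star_scale be_star_times be_star_star)+

end

text \<open>Only indices n \<open>\<ge>\<close> 1 are meant to be used.\<close>

lift_definition ann :: "nat \<Rightarrow> boson" is "\<lambda>n. BGen (n - 1)" .

lemma ann_ccr:
  assumes "n \<ge> 1" "m \<ge> 1"
  shows "ann n * (ann m)\<^sup>\<star> - (ann m)\<^sup>\<star> * ann n = (if n = m then 1 else 0)"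
proof -
  have "n - 1 = m - 1 \<longleftrightarrow> n = m" using assms by auto
  then show ?thesis
    using be_ccr[of "n - 1" "m - 1"] unfolding bcomm_def
    by transfer auto
qed

lemma ann_commute: "ann n * ann m - ann m * ann n = 0"
  by transfer (rule be_ann[unfolded bcomm_def])

lemma cre_commute: "(ann n)\<^sup>\<star> * (ann m)\<^sup>\<star> - (ann m)\<^sup>\<star> * (ann n)\<^sup>\<star> = 0"
  by transfer (rule be_cre[unfolded bcomm_def])

section \<open>Representations of bosons on dense domains\<close>

text \<open>\<open>adjoint_on D x y\<close>: the Hilbert space adjoint of the operator x with domain D, taken in
  the closure of D, is defined on all of D and agrees there with y.\<close>

definition adjoint_on :: "'h::complex_hilbert_space set \<Rightarrow> ('h \<Rightarrow> 'h) \<Rightarrow> ('h \<Rightarrow> 'h) \<Rightarrow> bool" where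
  "adjoint_on D x y \<longleftrightarrow> (\<forall>u\<in>D. \<forall>v\<in>D. cinner (x u) v = cinner u (y v))"

text \<open>Endomorphisms x of D whose adjoint maps D into D. Operators are total functions whose
  values outside of D are irrelevant.\<close>

definition adjointable_endos :: "'h::complex_hilbert_space set \<Rightarrow> ('h \<Rightarrow> 'h) set" where
  "adjointable_endos D = {x. clinear_into D D x \<and> (\<exists>y. clinear_into D D y \<and> adjoint_on D x y)}"

definition boson_action ::
    "'h::complex_hilbert_space set \<Rightarrow> (boson \<Rightarrow> 'h \<Rightarrow> 'h) \<Rightarrow> bool" where
  "boson_action D \<eta> \<longleftrightarrow> csubspace D \<and> (\<forall>x. \<eta> x \<in> adjointable_endos D) \<and>
     (\<forall>x y. \<forall>u\<in>D. \<eta> (x + y) u = \<eta> x u + \<eta> y u) \<and>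
     (\<forall>c x. \<forall>u\<in>D. \<eta> (c *\<^sub>C x) u = c *\<^sub>C \<eta> x u) \<and>
     (\<forall>x y. \<forall>u\<in>D. \<eta> (x * y) u = \<eta> x (\<eta> y u)) \<and>
     (\<forall>u\<in>D. \<eta> 1 u = u) \<and>
     (\<forall>x. adjoint_on D (\<eta> x) (\<eta> (x\<^sup>\<star>)))"

definition boson_cyclic ::
    "'h::complex_hilbert_space set \<Rightarrow> (boson \<Rightarrow> 'h \<Rightarrow> 'h) \<Rightarrow> 'h \<Rightarrow> bool" where
  "boson_cyclic D \<eta> \<Omega> \<longleftrightarrow> \<Omega> \<in> D \<and> range (\<lambda>x. \<eta> x \<Omega>) = D"

definition fock_representation ::
    "'h::complex_hilbert_space set \<Rightarrow> (boson \<Rightarrow> 'h \<Rightarrow> 'h) \<Rightarrow> 'h \<Rightarrow> bool" where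
  "fock_representation D \<eta> \<Omega> \<longleftrightarrow>
     boson_action D \<eta> \<and> boson_cyclic D \<eta> \<Omega> \<and> (\<forall>n\<ge>1. \<eta> (ann n) \<Omega> = 0)"

text \<open>The commutant of the possibly unbounded operators \<open>\<eta> x\<close> in the bounded operators on the
  closure of D: the operator \<open>T \<eta>(x)\<close> on D equals \<open>\<eta>(x\<^sup>\<star>)\<^sup>* T\<close>, where the outer star is the
  Hilbert space adjoint. A bounded T that maps D into D and commutes with all \<open>\<eta> x\<close> on D
  belongs to this set, so that irreducibility below is the strongest of the usual variants.\<close>

definition boson_commutant ::
    "'h::complex_hilbert_space set \<Rightarrow> (boson \<Rightarrow> 'h \<Rightarrow> 'h) \<Rightarrow> ('h \<Rightarrow> 'h) set" where
  "boson_commutant D \<eta> = {T. bounded_operator_on (closure D) T \<and>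
     (\<forall>x. \<forall>u\<in>D. \<forall>v\<in>D. cinner (T (\<eta> x u)) v = cinner (T u) (\<eta> (x\<^sup>\<star>) v))}"

definition boson_irreducible ::
    "'h::complex_hilbert_space set \<Rightarrow> (boson \<Rightarrow> 'h \<Rightarrow> 'h) \<Rightarrow> bool" where
  "boson_irreducible D \<eta> \<longleftrightarrow>
     (\<forall>T \<in> boson_commutant D \<eta>. \<exists>c. \<forall>u \<in> closure D. T u = c *\<^sub>C u)"

definition unitary_between ::
    "'h::complex_hilbert_space set \<Rightarrow> 'k::complex_hilbert_space set \<Rightarrow> ('h \<Rightarrow> 'k) \<Rightarrow> bool" where
  "unitary_between K L U \<longleftrightarrow> clinear_into K L U \<and> U ` K = L \<and>
     (\<forall>u\<in>K. \<forall>v\<in>K. cinner (U u) (U v) = cinner u v)"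

definition boson_unitarily_equivalent ::
    "'h::complex_hilbert_space set \<Rightarrow> (boson \<Rightarrow> 'h \<Rightarrow> 'h) \<Rightarrow>
     'k::complex_hilbert_space set \<Rightarrow> (boson \<Rightarrow> 'k \<Rightarrow> 'k) \<Rightarrow> bool" where
  "boson_unitarily_equivalent D \<eta> E \<theta> \<longleftrightarrow>
     (\<exists>U. unitary_between (closure D) (closure E) U \<and> U ` D = E \<and>
          (\<forall>x. \<forall>u\<in>D. U (\<eta> x u) = \<theta> x (U u)))"

section \<open>The boson representations inside representations of the Cuntz algebra\<close>

definition eta_single ::
    "nat \<Rightarrow> 'h::complex_hilbert_space \<Rightarrow> 'h set \<Rightarrow> (boson \<Rightarrow> 'h \<Rightarrow> 'h) \<Rightarrow> bool" where
  "eta_single j \<Omega> D \<eta> \<longleftrightarrow>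
     closure D = UNIV \<and> boson_action D \<eta> \<and> boson_cyclic D \<eta> \<Omega> \<and>
     (\<forall>n\<ge>1. \<eta> (ann n * (ann n)\<^sup>\<star>) \<Omega> = of_nat j *\<^sub>C \<Omega>)"

text \<open>The sum of V1 and V2 is an orthogonal direct sum.\<close>

definition eta_pair ::
    "'h::complex_hilbert_space \<Rightarrow> 'h \<Rightarrow> 'h set \<Rightarrow> 'h set \<Rightarrow>
     (boson \<Rightarrow> 'h \<Rightarrow> 'h) \<Rightarrow> (boson \<Rightarrow> 'h \<Rightarrow> 'h) \<Rightarrow> bool" where
  "eta_pair \<Omega> \<Omega>' V1 V2 \<eta>12 \<eta>21 \<longleftrightarrow>
     boson_action V1 \<eta>12 \<and> boson_action V2 \<eta>21 \<and>
     (\<forall>u\<in>V1. \<forall>v\<in>V2. cinner u v = 0) \<and> closure {u + v | u v. u \<in> V1 \<and> v \<in> V2} = UNIV \<and>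
     boson_cyclic V1 \<eta>12 \<Omega> \<and> boson_cyclic V2 \<eta>21 \<Omega>' \<and>
     (\<forall>n\<ge>1. \<eta>12 (ann (2 * n - 1)) \<Omega> = 0 \<and> \<eta>21 (ann (2 * n)) \<Omega>' = 0 \<and>
        \<eta>12 ((ann (2 * n))\<^sup>\<star> * ann (2 * n)) \<Omega> = \<Omega> \<and>
        \<eta>21 ((ann (2 * n - 1))\<^sup>\<star> * ann (2 * n - 1)) \<Omega>' = \<Omega>')"

text \<open>\<open>eta_representation s l D \<eta>\<close>: the pair (D, \<open>\<eta>\<close>) is a representation named by the label l,
  obtained from some representation of the Cuntz algebra as in the definitions above.\<close>

datatype eta_label = Eta nat | Eta12 | Eta21

definition eta_labels :: "eta_label set" where
  "eta_labels = {Eta j | j. j \<ge> 1} \<union> {Eta12, Eta21}"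

fun eta_representation ::
    "(nat \<Rightarrow> 'o::cstar_algebra) \<Rightarrow> eta_label \<Rightarrow>
     'h::complex_hilbert_space set \<Rightarrow> (boson \<Rightarrow> 'h \<Rightarrow> 'h) \<Rightarrow> bool" where
  "eta_representation s (Eta j) D \<eta> \<longleftrightarrow>
     (\<exists>(\<pi> :: 'o \<Rightarrow> 'h \<Rightarrow> 'h) \<Omega>. cstar_representation \<pi> \<and> cyclic_vector \<pi> \<Omega> \<and> \<pi> (s j) \<Omega> = \<Omega> \<and>
        eta_single j \<Omega> D \<eta>)"
| "eta_representation s Eta12 D \<eta> \<longleftrightarrow>
     (\<exists>(\<pi> :: 'o \<Rightarrow> 'h \<Rightarrow> 'h) \<Omega> V2 \<eta>21. cstar_representation \<pi> \<and> cyclic_vector \<pi> \<Omega> \<and>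
        \<pi> (s 1 * s 2) \<Omega> = \<Omega> \<and> eta_pair \<Omega> (\<pi> (s 2) \<Omega>) D V2 \<eta> \<eta>21)"
| "eta_representation s Eta21 D \<eta> \<longleftrightarrow>
     (\<exists>(\<pi> :: 'o \<Rightarrow> 'h \<Rightarrow> 'h) \<Omega> V1 \<eta>12. cstar_representation \<pi> \<and> cyclic_vector \<pi> \<Omega> \<and>
        \<pi> (s 1 * s 2) \<Omega> = \<Omega> \<and> eta_pair \<Omega> (\<pi> (s 2) \<Omega>) V1 D \<eta>12 \<eta>)"

end

(* Words in the isometries of the Cuntz algebra applied to the cyclic vector form an orthogonal
   family of vectors indexed by occupation numbers m that agree with a reference sequence k up to
   finitely many places: m corresponds to s_{m(0)+1} s_{m(1)+1} ..., an infinite word with tail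
   given by k. On the span of this family the bosons act by the usual raising and lowering
   operators. The family is total because a representation of a C*-algebra is automatically
   contractive, so that the dense star-subalgebra generated by the isometries suffices.

   Conversely, let a cyclic vector of any boson action have the occupation numbers k. Applying
   creation operators where m(n) >= k(n) and annihilation operators where m(n) <= k(n) gives joint
   eigenvectors of the number operators that span the domain, and only the multiples of the cyclic
   vector have the occupation numbers k. An operator in the commutant maps the cyclic vector to a
   vector with the same occupation numbers, hence is a scalar; and equivalent actions have
   reference sequences that differ at finitely many places only. *)

theory Submission
  imports Defs
begin

section \<open>Complex Hilbert spaces and automatic continuity\<close>

text \<open>A representation bounds each \<open>\<pi> x\<close> separately, with a constant that may
  depend on x, while the density argument needs continuity in x. The uniform bound rests on a square
  root of 1 - d, where d is \<open>x\<^sup>\<star> * x\<close> scaled to norm below 1; a fixed point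
  iteration supplies this root in place of functional calculus.

  On the boson side the obstacle is that an operator T of the commutant may move the cyclic vector
  out of D, where the unbounded number operators are not defined. Eigenvalue equations are therefore
  only tested against vectors of D, and a vector of the closure is shown to vanish by orthogonality
  to a spanning set of D. Uniqueness of the vector with the occupation numbers k becomes a matter of
  syntax: a product with at least one step away from k cannot have the occupation numbers k. The
  price is that such products must be shown to be stable under steps back towards k. There the
  commutation relations are used, together with positivity, which turns the occupation number 0 into
  annihilation.\<close>

interpretation cvec: vector_space "scaleC :: complex \<Rightarrow> 'a \<Rightarrow> 'a::complex_vector"
  by unfold_locales (simp_all add: scaleC_add_right scaleC_add_left scaleC_scaleC scaleC_one)

lemma csubspace_iff_subspace: "csubspace D \<longleftrightarrow> cvec.subspace D"
  unfolding csubspace_def cvec.subspace_def by auto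

lemma cinner_add_left: "cinner (x + y) z = cinner x z + cinner y z"
  for x :: "'a::complex_hilbert_space"
  by (metis cinner_add_right cinner_commute complex_cnj_add)

lemma cinner_scaleC_left: "cinner (c *\<^sub>C x) y = cnj c * cinner x y"
  for x :: "'a::complex_hilbert_space"
  by (metis cinner_scaleC_right cinner_commute complex_cnj_mult)

lemma cinner_zero_left [simp]: "cinner 0 x = 0" for x :: "'a::complex_hilbert_space"
  using cinner_scaleC_left[of 0 x x] by simp

lemma cinner_zero_right [simp]: "cinner x 0 = 0" for x :: "'a::complex_hilbert_space"
  using cinner_scaleC_right[of x 0 x] by simp

lemma cinner_minus_left: "cinner (- x) y = - cinner x y" for x :: "'a::complex_hilbert_space"
  using cinner_scaleC_left[of "-1" x y] by simp

lemma cinner_diff_left: "cinner (x - y) z = cinner x z - cinner y z"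
  for x :: "'a::complex_hilbert_space"
  using cinner_add_left[of x "- y" z] by (simp add: cinner_minus_left)

lemma cinner_sum_left: "cinner (\<Sum>i\<in>I. f i) y = (\<Sum>i\<in>I. cinner (f i) y)"
  for y :: "'a::complex_hilbert_space"
  by (induction I rule: infinite_finite_induct) (simp_all add: cinner_add_left)

lemma cinner_sum_right: "cinner y (\<Sum>i\<in>I. f i) = (\<Sum>i\<in>I. cinner y (f i))"
  for y :: "'a::complex_hilbert_space"
  by (induction I rule: infinite_finite_induct) (simp_all add: cinner_add_right)

lemma cinner_self: "cinner x x = complex_of_real ((norm x)\<^sup>2)"
  for x :: "'a::complex_hilbert_space"
proof (rule complex_eqI)
  show "Re (cinner x x) = Re (complex_of_real ((norm x)\<^sup>2))"
    by (simp add: inner_eq_Re_cinner[symmetric] power2_norm_eq_inner)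
  show "Im (cinner x x) = Im (complex_of_real ((norm x)\<^sup>2))"
    using arg_cong[OF cinner_commute[of x x], of Im] by simp
qed

lemma cinner_self_eq_zero [simp]: "cinner x x = 0 \<longleftrightarrow> x = 0" for x :: "'a::complex_hilbert_space"
  by (simp add: cinner_self)

lemma norm_scaleC: "norm (c *\<^sub>C x) = cmod c * norm x" for x :: "'a::complex_hilbert_space"
proof -
  have "complex_of_real ((norm (c *\<^sub>C x))\<^sup>2) = cnj c * c * complex_of_real ((norm x)\<^sup>2)"
    unfolding cinner_self[symmetric] by (simp add: cinner_scaleC_left cinner_scaleC_right)
  also have "cnj c * c = complex_of_real ((cmod c)\<^sup>2)"
    unfolding complex_norm_square by (rule mult.commute)
  finally have "complex_of_real ((norm (c *\<^sub>C x))\<^sup>2) = complex_of_real ((cmod c * norm x)\<^sup>2)"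
    by (simp add: power_mult_distrib)
  then have "(norm (c *\<^sub>C x))\<^sup>2 = (cmod c * norm x)\<^sup>2"
    by (simp only: of_real_eq_iff)
  then show ?thesis by (simp add: power2_eq_iff_nonneg)
qed

lemma tendsto_scaleC:
  fixes f :: "'b \<Rightarrow> 'a::complex_hilbert_space"
  assumes "(f \<longlongrightarrow> u) F"
  shows "((\<lambda>x. c *\<^sub>C f x) \<longlongrightarrow> c *\<^sub>C u) F"
proof -
  have "norm (c *\<^sub>C f x - c *\<^sub>C u) = cmod c * norm (f x - u)" for x
    by (simp only: cvec.scale_right_diff_distrib[symmetric] norm_scaleC)
  moreover have "((\<lambda>x. norm (f x - u)) \<longlongrightarrow> 0) F"
    using assms by (simp add: tendsto_norm_zero_iff LIM_zero_iff)
  then have "((\<lambda>x. cmod c * norm (f x - u)) \<longlongrightarrow> 0) F"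
    by (rule tendsto_mult_right_zero)
  ultimately have "((\<lambda>x. norm (c *\<^sub>C f x - c *\<^sub>C u)) \<longlongrightarrow> 0) F" by simp
  then show ?thesis by (simp only: tendsto_norm_zero_iff LIM_zero_iff)
qed

lemma csubspace_closure:
  assumes "csubspace (D :: 'a::complex_hilbert_space set)"
  shows "csubspace (closure D)"
  unfolding csubspace_def
proof (intro conjI ballI allI)
  show "0 \<in> closure D" using assms closure_subset[of D] by (auto simp: csubspace_def)
next
  fix u v assume "u \<in> closure D" "v \<in> closure D"
  then obtain f g where f: "\<forall>n. f n \<in> D" "f \<longlonglongrightarrow> u" and g: "\<forall>n. g n \<in> D" "g \<longlonglongrightarrow> v"
    by (auto simp: closure_sequential)
  have "(\<lambda>n. f n + g n) \<longlonglongrightarrow> u + v" using f g by (intro tendsto_add)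
  moreover have "\<forall>n. f n + g n \<in> D" using assms f g by (simp add: csubspace_def)
  ultimately show "u + v \<in> closure D"
    unfolding closure_sequential by (intro exI[of _ "\<lambda>n. f n + g n"] conjI)
next
  fix c u assume "u \<in> closure D"
  then obtain f where f: "\<forall>n. f n \<in> D" "f \<longlonglongrightarrow> u" by (auto simp: closure_sequential)
  then have "(\<lambda>n. c *\<^sub>C f n) \<longlonglongrightarrow> c *\<^sub>C u" by (intro tendsto_scaleC)
  moreover have "\<forall>n. c *\<^sub>C f n \<in> D" using assms f by (simp add: csubspace_def)
  ultimately show "c *\<^sub>C u \<in> closure D"
    unfolding closure_sequential by (intro exI[of _ "\<lambda>n. c *\<^sub>C f n"] conjI)
qed

text \<open>The real inner product suffices: it is continuous, and the case w = u already forces u =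
  0.\<close>

lemma closure_orthogonal:
  fixes u :: "'a::complex_hilbert_space"
  assumes "\<And>v. v \<in> D \<Longrightarrow> cinner u v = 0" "w \<in> closure D"
  shows "inner u w = 0"
proof -
  obtain f where f: "\<forall>n. f n \<in> D" "f \<longlonglongrightarrow> w" using assms(2) by (auto simp: closure_sequential)
  have "(\<lambda>n. inner u (f n)) \<longlonglongrightarrow> inner u w" using f(2) by (intro tendsto_intros)
  moreover have "inner u (f n) = 0" for n using assms(1) f(1) by (simp add: inner_eq_Re_cinner)
  ultimately show ?thesis by (simp add: LIMSEQ_const_iff)
qed

section \<open>Square roots in C*-algebras and contractivity of representations\<close>

lemma star_zero [simp]: "(0 :: 'a::star_algebra)\<^sup>\<star> = 0"
  using star_scaleC[of 0 "0 :: 'a"] by simp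

lemma star_one [simp]: "(1 :: 'a::star_algebra)\<^sup>\<star> = 1"
  using star_mult[of "1\<^sup>\<star>" "1 :: 'a"] by (simp add: star_star)

lemma star_diff: "(x - y)\<^sup>\<star> = x\<^sup>\<star> - y\<^sup>\<star>" for x :: "'a::star_algebra"
  using star_add[of "x - y" y] by (simp add: algebra_simps)

lemma norm_star [simp]: "norm (x\<^sup>\<star>) = norm x" for x :: "'a::cstar_algebra"
proof -
  have le: "norm y \<le> norm (y\<^sup>\<star>)" for y :: 'a
  proof (cases "y = 0")
    case False
    have "norm y * norm y \<le> norm (y\<^sup>\<star>) * norm y"
      using norm_mult_ineq[of "y\<^sup>\<star>" y] by (simp add: cstar_identity power2_eq_square)
    then show ?thesis using False by simp
  qed simp
  show ?thesis using le[of x] le[of "x\<^sup>\<star>"] by (simp add: star_star)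
qed

lemma star_scaleR: "(r *\<^sub>R x)\<^sup>\<star> = r *\<^sub>R x\<^sup>\<star>" for x :: "'a::cstar_algebra"
  by (simp add: scaleR_eq_scaleC_alg star_scaleC)

text \<open>The square root is \<open>1 - z\<close>, where z is the fixed point of the contraction
  \<open>z \<mapsto> (h + z\<^sup>2) / 2\<close> on a small ball of selfadjoint elements.\<close>

lemma cstar_sqrt_exists:
  fixes h :: "'a::cstar_algebra"
  assumes sa: "h\<^sup>\<star> = h" and h: "norm h < 1"
  shows "\<exists>y. y\<^sup>\<star> * y = 1 - h"
proof -
  \<comment> \<open>The smaller root of \<open>2 * q = norm h + q * q\<close>: the ball of radius q
    is then mapped into itself, and q < 1 serves as contraction constant.\<close>
  define q where "q = 1 - sqrt (1 - norm h)"
  define B where "B = {z :: 'a. norm z \<le> q \<and> z\<^sup>\<star> = z}"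
  define f where "f z = (1/2) *\<^sub>R (h + z * z)" for z :: 'a
  have sq: "(sqrt (1 - norm h))\<^sup>2 = 1 - norm h" using h by simp
  have q: "0 \<le> q" "q < 1" using h by (auto simp: q_def)
  have q2: "norm h + q * q = 2 * q"
    using sq by (simp add: q_def power2_eq_square algebra_simps)
  \<comment> \<open>The involution is isometric, so selfadjointness passes to limits and B is
    complete.\<close>
  have "continuous_on UNIV (star :: 'a \<Rightarrow> 'a)"
    by (rule lipschitz_on_continuous_on[where L = 1]) (simp add: lipschitz_on_def dist_norm star_diff[symmetric])
  then have "closed {z :: 'a. z\<^sup>\<star> = z}"
    by (intro closed_Collect_eq continuous_on_id)
  then have "closed B"
    unfolding B_def Collect_conj_eq by (intro closed_Int closed_Collect_le continuous_intros)
  then have "complete B" by (simp add: complete_eq_closed)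
  moreover have "B \<noteq> {}" using q by (auto simp: B_def intro!: exI[of _ 0])
  moreover have "f ` B \<subseteq> B"
  proof safe
    fix z assume "z \<in> B"
    then have z: "norm z \<le> q" "z\<^sup>\<star> = z" by (auto simp: B_def)
    have "norm (h + z * z) \<le> norm h + q * q"
      by (meson add_left_mono mult_mono norm_ge_zero norm_mult_ineq norm_triangle_ineq order_trans q z)
    then show "f z \<in> B"
      using z by (simp add: B_def f_def q2 star_scaleR star_add star_mult sa)
  qed
  moreover have "dist (f z) (f w) \<le> q * dist z w" if "z \<in> B" "w \<in> B" for z w
  proof -
    have zw: "norm z \<le> q" "norm w \<le> q" using that by (auto simp: B_def)
    \<comment> \<open>This splitting of the difference of two squares does not need z and w to
      commute.\<close>
    have "f z - f w = (1/2) *\<^sub>R (z * (z - w) + (z - w) * w)"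
      by (simp add: f_def algebra_simps)
    moreover have "norm (z * (z - w) + (z - w) * w) \<le> norm z * norm (z - w) + norm (z - w) * norm w"
      by (meson add_mono norm_mult_ineq norm_triangle_ineq order_trans)
    moreover have "\<dots> \<le> q * norm (z - w) + norm (z - w) * q"
      using zw q by (intro add_mono mult_mono) auto
    ultimately show ?thesis by (simp add: dist_norm)
  qed
  ultimately obtain z where z: "z \<in> B" "f z = z"
    using Banach_fix[of B q f] q by blast
  have "2 *\<^sub>R f z = h + z * z" by (simp add: f_def)
  then have "h + z * z = 2 *\<^sub>R z" using z(2) by simp
  then have "(1 - z)\<^sup>\<star> * (1 - z) = 1 - h"
    using z(1) by (simp add: B_def star_diff algebra_simps scaleR_2)
  then show ?thesis by blast
qed

text \<open>For c > norm x the square root gives y with \<open>y\<^sup>\<star> * y = 1 - h\<close>,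
  where h is \<open>x\<^sup>\<star> * x\<close> divided by the square of c. Hence the squares of
  \<open>norm (\<pi> y u)\<close> and of \<open>norm (\<pi> x u) / c\<close> add up to the square of
  \<open>norm u\<close>. Then c decreases to norm x.\<close>

lemma cstar_representation_contractive:
  fixes \<pi> :: "'o::cstar_algebra \<Rightarrow> 'h::complex_hilbert_space \<Rightarrow> 'h"
  assumes \<pi>: "cstar_representation \<pi>"
  shows "norm (\<pi> x u) \<le> norm x * norm u"
proof (cases "u = 0")
  case True
  have "\<pi> x (0 *\<^sub>C u) = 0 *\<^sub>C \<pi> x u"
    using \<pi> unfolding cstar_representation_def bounded_operator_on_def clinear_into_def by blast
  with True have "\<pi> x u = 0" by simp
  then show ?thesis by simp
next
  case False
  have add: "\<pi> (a + b) v = \<pi> a v + \<pi> b v" and sc: "\<pi> (c *\<^sub>C a) v = c *\<^sub>C \<pi> a v"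
    and mu: "\<pi> (a * b) v = \<pi> a (\<pi> b v)" and one: "\<pi> 1 v = v"
    and adj: "cinner (\<pi> (a\<^sup>\<star>) v) w = cinner v (\<pi> a w)" for a b c v w
    using \<pi> unfolding cstar_representation_def by auto
  have adj': "cinner (\<pi> a v) w = cinner v (\<pi> (a\<^sup>\<star>) w)" for a v w
    using adj[of "a\<^sup>\<star>"] by (simp add: star_star)
  have sqn: "cinner (\<pi> a u) (\<pi> a u) = cinner u (\<pi> (a\<^sup>\<star> * a) u)" for a
    by (simp add: adj' mu)
  have bound: "norm (\<pi> x u) / norm u \<le> c" if c: "norm x < c" for c
  proof -
    have c0: "0 < c" using c norm_ge_zero[of x] by linarith
    define d where "d = 1 / c\<^sup>2"
    define h where "h = d *\<^sub>R (x\<^sup>\<star> * x)"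
    have "(norm x)\<^sup>2 < c\<^sup>2" using c by (simp add: power_strict_mono)
    then have "norm h < 1" using c0 by (simp add: h_def d_def cstar_identity)
    moreover have "h\<^sup>\<star> = h" by (simp add: h_def star_scaleR star_mult star_star)
    ultimately obtain y where y: "y\<^sup>\<star> * y = 1 - h" using cstar_sqrt_exists by blast
    have "\<pi> 1 u = \<pi> (y\<^sup>\<star> * y) u + \<pi> h u" by (simp add: add[symmetric] y)
    moreover have "cinner u (\<pi> h u) = complex_of_real d * cinner u (\<pi> (x\<^sup>\<star> * x) u)"
      by (simp only: h_def scaleR_eq_scaleC_alg sc cinner_scaleC_right)
    ultimately have "cinner u u = cinner (\<pi> y u) (\<pi> y u) + complex_of_real d * cinner (\<pi> x u) (\<pi> x u)"
      by (metis sqn one cinner_add_right)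
    then have "complex_of_real ((norm (\<pi> y u))\<^sup>2 + d * (norm (\<pi> x u))\<^sup>2) = complex_of_real ((norm u)\<^sup>2)"
      unfolding cinner_self by simp
    then have "(norm (\<pi> y u))\<^sup>2 + d * (norm (\<pi> x u))\<^sup>2 = (norm u)\<^sup>2"
      using of_real_eq_iff by blast
    then have "d * (norm (\<pi> x u))\<^sup>2 \<le> (norm u)\<^sup>2" by (metis add_increasing order_refl zero_le_power2)
    then have "(norm (\<pi> x u))\<^sup>2 \<le> (c * norm u)\<^sup>2"
      using c0 by (simp add: d_def field_simps)
    then have "norm (\<pi> x u) \<le> c * norm u"
      by (rule power2_le_imp_le) (use c0 in simp)
    then show ?thesis using False by (simp add: field_simps)
  qed
  then have "norm (\<pi> x u) / norm u \<le> norm x" by (rule dense_ge)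
  then show ?thesis using False by (simp add: field_simps)
qed

section \<open>The boson algebra acting on functions of occupation numbers\<close>

type_synonym occ_fun = "(nat \<Rightarrow> nat) \<Rightarrow> complex"

text \<open>The value f m is the coefficient of the basis vector with occupation numbers m.
  Annihilation at n therefore reads its value at m from the sequence with one more quantum at n.
  Positions start at 0 and belong to \<open>ann (Suc n)\<close>.\<close>

definition lower_op :: "nat \<Rightarrow> occ_fun \<Rightarrow> occ_fun" where
  "lower_op n f m = complex_of_real (sqrt (real (Suc (m n)))) * f (m(n := Suc (m n)))"

definition raise_op :: "nat \<Rightarrow> occ_fun \<Rightarrow> occ_fun" where
  "raise_op n f m = (if m n = 0 then 0 else complex_of_real (sqrt (real (m n))) * f (m(n := m n - 1)))"

text \<open>The flag selects the adjoint operator. Interpreting a term together with its adjoint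
  avoids any convergence question: both act on all functions of the occupation numbers.\<close>

primrec fock_op :: "boson_term \<Rightarrow> bool \<Rightarrow> occ_fun \<Rightarrow> occ_fun" where
  "fock_op (BGen n) b f = (if b then raise_op n f else lower_op n f)"
| "fock_op BZero b f = (\<lambda>m. 0)"
| "fock_op BOne b f = f"
| "fock_op (BPlus x y) b f = (\<lambda>m. fock_op x b f m + fock_op y b f m)"
| "fock_op (BTimes x y) b f =
     (if b then fock_op y b (fock_op x b f) else fock_op x b (fock_op y b f))"
| "fock_op (BScale c x) b f = (\<lambda>m. (if b then cnj c else c) * fock_op x b f m)"
| "fock_op (BStar x) b f = fock_op x (\<not> b) f"

text \<open>Composition distributes over sums on one side by definition; the other distributive law
  of \<open>boson_eq\<close> needs additivity of the operators.\<close>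

lemma fock_op_add:
  "fock_op x b (\<lambda>m. f m + g m) = (\<lambda>m. fock_op x b f m + fock_op x b g m)"
proof (induction x arbitrary: b f g)
  case (BTimes x y)
  then show ?case by simp
qed (auto simp: fun_eq_iff lower_op_def raise_op_def distrib_left)

lemma fock_op_scale: "fock_op x b (\<lambda>m. c * f m) = (\<lambda>m. c * fock_op x b f m)"
proof (induction x arbitrary: b f)
  case (BTimes x y)
  then show ?case by simp
qed (auto simp: fun_eq_iff lower_op_def raise_op_def algebra_simps)

lemma of_real_sqrt_mult_self: "0 \<le> r \<Longrightarrow> complex_of_real (sqrt r) * complex_of_real (sqrt r) = complex_of_real r"
  by (metis of_real_mult real_sqrt_mult_self abs_of_nonneg)

lemma lower_op_raise_op_same: "lower_op n (raise_op n f) m = of_nat (Suc (m n)) * f m"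
  using of_real_sqrt_mult_self[of "real (Suc (m n))"]
  by (simp add: lower_op_def raise_op_def mult.assoc[symmetric])

lemma raise_op_lower_op_same: "raise_op n (lower_op n f) m = of_nat (m n) * f m"
  using of_real_sqrt_mult_self[of "real (m n)"]
  by (auto simp add: lower_op_def raise_op_def mult.assoc[symmetric])

lemma lower_op_raise_op_commute:
  "k \<noteq> l \<Longrightarrow> lower_op k (raise_op l f) m = raise_op l (lower_op k f) m"
  by (simp add: lower_op_def raise_op_def fun_upd_twist)

lemma lower_op_commute: "lower_op k (lower_op l f) m = lower_op l (lower_op k f) m"
  by (cases "k = l") (simp_all add: lower_op_def fun_upd_twist)

lemma raise_op_commute: "raise_op k (raise_op l f) m = raise_op l (raise_op k f) m"
  by (cases "k = l") (simp_all add: raise_op_def fun_upd_twist)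

text \<open>Both flags are treated at once because the congruence rule for \<open>BStar\<close>
  exchanges them. The flag True turns each commutation relation into its adjoint, which is again one
  of the relations.\<close>

lemma fock_op_boson_eq: "boson_eq x y \<Longrightarrow> fock_op x b f = fock_op y b f"
proof (induction arbitrary: b f rule: boson_eq.induct)
  case (be_ccr k l)
  show ?case
    by (cases "k = l"; cases b)
       (auto simp: bcomm_def fun_eq_iff lower_op_raise_op_same raise_op_lower_op_same
         lower_op_raise_op_commute algebra_simps)
next
  case (be_ann k l)
  show ?case by (auto simp: bcomm_def fun_eq_iff lower_op_commute[of k l] raise_op_commute[of k l])
next
  case (be_cre k l)
  show ?case by (auto simp: bcomm_def fun_eq_iff lower_op_commute[of k l] raise_op_commute[of k l])
next
  case (be_times x x' y y')
  then show ?case by simp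
qed (auto simp: fock_op_add fock_op_scale fun_eq_iff algebra_simps)

lift_definition fock_act :: "boson \<Rightarrow> bool \<Rightarrow> occ_fun \<Rightarrow> occ_fun" is fock_op
  by (simp add: fock_op_boson_eq fun_eq_iff)

lemma fock_act_simps:
  "fock_act (x + y) b f = (\<lambda>m. fock_act x b f m + fock_act y b f m)"
  "fock_act (c *\<^sub>C x) b f = (\<lambda>m. (if b then cnj c else c) * fock_act x b f m)"
  "fock_act (x * y) False f = fock_act x False (fock_act y False f)"
  "fock_act 1 b f = f"
  "fock_act (x\<^sup>\<star>) b f = fock_act x (\<not> b) f"
  "fock_act (ann n) False f = lower_op (n - 1) f"
  "fock_act (ann n) True f = raise_op (n - 1) f"
  by (transfer, simp)+

lemma fock_act_add: "fock_act x b (\<lambda>m. f m + g m) = (\<lambda>m. fock_act x b f m + fock_act x b g m)"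
  by transfer (rule fock_op_add)

lemma fock_act_scale: "fock_act x b (\<lambda>m. c * f m) = (\<lambda>m. c * fock_act x b f m)"
  by transfer (rule fock_op_scale)

section \<open>Finitely supported functions near a reference sequence\<close>

definition near :: "(nat \<Rightarrow> nat) \<Rightarrow> (nat \<Rightarrow> nat) set" where
  "near k = {m. finite {n. m n \<noteq> k n}}"

lemma near_refl [simp]: "k \<in> near k" by (simp add: near_def)

lemma near_upd_iff [simp]: "m(n := p) \<in> near k \<longleftrightarrow> m \<in> near k"
proof -
  have fin: "finite {i. (m(n := p)) i \<noteq> k i}" if "finite {i. m i \<noteq> k i}" for m :: "nat \<Rightarrow> nat" and p
    by (rule finite_subset[OF _ finite_insert[THEN iffD2, OF that, of n]]) auto
  show ?thesis using fin[of m p] fin[of "m(n := p)" "m n"] unfolding near_def fun_upd_upd fun_upd_triv by blast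
qed

definition supp :: "occ_fun \<Rightarrow> (nat \<Rightarrow> nat) set" where
  "supp f = {m. f m \<noteq> 0}"

definition fock_domain :: "(nat \<Rightarrow> nat) \<Rightarrow> occ_fun set" where
  "fock_domain k = {f. finite (supp f) \<and> supp f \<subseteq> near k}"

lemma fock_domain_add: "f \<in> fock_domain k \<Longrightarrow> g \<in> fock_domain k \<Longrightarrow> (\<lambda>m. f m + g m) \<in> fock_domain k"
proof -
  assume "f \<in> fock_domain k" "g \<in> fock_domain k"
  moreover have "supp (\<lambda>m. f m + g m) \<subseteq> supp f \<union> supp g" by (auto simp: supp_def)
  ultimately show ?thesis by (auto simp: fock_domain_def intro: finite_subset)
qed

lemma fock_domain_scale: "f \<in> fock_domain k \<Longrightarrow> (\<lambda>m. c * f m) \<in> fock_domain k"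
proof -
  assume "f \<in> fock_domain k"
  moreover have "supp (\<lambda>m. c * f m) \<subseteq> supp f" by (auto simp: supp_def)
  ultimately show ?thesis by (auto simp: fock_domain_def intro: finite_subset)
qed

lemma fock_domain_lower_op:
  assumes "f \<in> fock_domain k" shows "lower_op n f \<in> fock_domain k"
proof -
  \<comment> \<open>The sequence found in \<open>supp f\<close> has a positive entry at n, so the
    truncated subtraction really inverts the shift there.\<close>
  have sub: "supp (lower_op n f) \<subseteq> (\<lambda>m. m(n := m n - 1)) ` supp f"
  proof
    fix m assume "m \<in> supp (lower_op n f)"
    then have "m(n := Suc (m n)) \<in> supp f" by (auto simp: supp_def lower_op_def)
    moreover have "m = (m(n := Suc (m n)))(n := (m(n := Suc (m n))) n - 1)" by simp
    ultimately show "m \<in> (\<lambda>m. m(n := m n - 1)) ` supp f" by blast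
  qed
  have "finite (supp (lower_op n f))"
    using sub assms by (auto simp: fock_domain_def intro: finite_subset)
  moreover have "supp (lower_op n f) \<subseteq> near k"
    using sub assms by (fastforce simp: fock_domain_def)
  ultimately show ?thesis by (simp add: fock_domain_def)
qed

lemma fock_domain_raise_op:
  assumes "f \<in> fock_domain k" shows "raise_op n f \<in> fock_domain k"
proof -
  have sub: "supp (raise_op n f) \<subseteq> (\<lambda>m. m(n := Suc (m n))) ` supp f"
  proof
    fix m assume "m \<in> supp (raise_op n f)"
    then have "m(n := m n - 1) \<in> supp f" and pos: "m n \<noteq> 0"
      by (auto simp: supp_def raise_op_def split: if_splits)
    moreover have "m = (m(n := m n - 1))(n := Suc ((m(n := m n - 1)) n))" using pos by simp
    ultimately show "m \<in> (\<lambda>m. m(n := Suc (m n))) ` supp f" by blast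
  qed
  have "finite (supp (raise_op n f))"
    using sub assms by (auto simp: fock_domain_def intro: finite_subset)
  moreover have "supp (raise_op n f) \<subseteq> near k"
    using sub assms by (fastforce simp: fock_domain_def)
  ultimately show ?thesis by (simp add: fock_domain_def)
qed

lemma fock_domain_fock_act: "f \<in> fock_domain k \<Longrightarrow> fock_act x b f \<in> fock_domain k"
proof (transfer fixing: k)
  show "f \<in> fock_domain k \<Longrightarrow> fock_op x b f \<in> fock_domain k" for f x b
  proof (induction x arbitrary: b f)
    case BZero
    show ?case by (simp add: fock_domain_def supp_def)
  qed (simp_all add: fock_domain_lower_op fock_domain_raise_op fock_domain_add fock_domain_scale)
qed

text \<open>Antilinear in the first argument, as \<open>cinner\<close> is. Summing over the support
  of f alone keeps the sum finite for finitely supported f and arbitrary g.\<close>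

definition pairing :: "occ_fun \<Rightarrow> occ_fun \<Rightarrow> complex" where
  "pairing f g = (\<Sum>m\<in>supp f. cnj (f m) * g m)"

lemma pairing_superset: "finite A \<Longrightarrow> supp f \<subseteq> A \<Longrightarrow> pairing f g = (\<Sum>m\<in>A. cnj (f m) * g m)"
  unfolding pairing_def by (rule sum.mono_neutral_left) (auto simp: supp_def)

lemma pairing_cnj:
  assumes "finite (supp f)" "finite (supp g)"
  shows "pairing f g = cnj (pairing g f)"
  using assms by (simp add: pairing_superset[of "supp f \<union> supp g"] mult.commute)

lemma pairing_add:
  assumes "finite (supp f)" "finite (supp f')"
  shows "pairing (\<lambda>m. f m + f' m) g = pairing f g + pairing f' g"
proof -
  have "supp (\<lambda>m. f m + f' m) \<subseteq> supp f \<union> supp f'" by (auto simp: supp_def)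
  then show ?thesis
    using assms by (simp add: pairing_superset[of "supp f \<union> supp f'"] sum.distrib distrib_right)
qed

lemma pairing_add_right: "pairing f (\<lambda>m. g m + g' m) = pairing f g + pairing f g'"
  by (simp add: pairing_def sum.distrib distrib_left)

lemma pairing_scale_right: "pairing f (\<lambda>m. c * g m) = c * pairing f g"
  by (simp add: pairing_def sum_distrib_left mult_ac)

lemma pairing_scale:
  assumes "finite (supp f)"
  shows "pairing (\<lambda>m. c * f m) g = cnj c * pairing f g"
proof -
  have "supp (\<lambda>m. c * f m) \<subseteq> supp f" by (auto simp: supp_def)
  then show ?thesis
    using assms by (simp add: pairing_superset[of "supp f"] sum_distrib_left mult_ac)
qed

text \<open>Shift the summation index by one quantum at n. Only sequences with a nonzero entry at n
  contribute on the right, and on these the shift is invertible.\<close>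

lemma pairing_lower_op:
  assumes "finite (supp f)"
  shows "pairing (lower_op n f) g = pairing f (raise_op n g)"
proof -
  have "pairing f (raise_op n g) = (\<Sum>m\<in>{m \<in> supp f. m n \<noteq> 0}. cnj (f m) * raise_op n g m)"
    unfolding pairing_def
    by (rule sum.mono_neutral_right[OF assms]) (auto simp: raise_op_def)
  also have "\<dots> = (\<Sum>m\<in>supp (lower_op n f). cnj (lower_op n f m) * g m)"
    by (rule sum.reindex_bij_witness[where i = "\<lambda>m. m(n := Suc (m n))" and j = "\<lambda>m. m(n := m n - 1)"])
       (auto simp: supp_def lower_op_def raise_op_def)
  finally show ?thesis by (simp add: pairing_def)
qed

lemma pairing_fock_act:
  assumes "f \<in> fock_domain k" "g \<in> fock_domain k"
  shows "pairing (fock_act x b f) g = pairing f (fock_act x (\<not> b) g)"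
  using assms
proof (transfer fixing: k)
  have fin: "finite (supp f)" if "f \<in> fock_domain k" for f using that by (simp add: fock_domain_def)
  have dom: "fock_op x b f \<in> fock_domain k" if "f \<in> fock_domain k" for x b f
    using fock_domain_fock_act[OF that, of "abs_boson x" b] by (simp add: fock_act.abs_eq)
  have raise: "pairing (raise_op n f) g = pairing f (lower_op n g)"
    if "f \<in> fock_domain k" "g \<in> fock_domain k" for f g n
    using that pairing_lower_op[of g n f] pairing_cnj[of "raise_op n f" g]
      pairing_cnj[of f "lower_op n g"] fin fock_domain_raise_op fock_domain_lower_op by simp
  show "f \<in> fock_domain k \<Longrightarrow> g \<in> fock_domain k \<Longrightarrow>
      pairing (fock_op x b f) g = pairing f (fock_op x (\<not> b) g)" for f g x b
  proof (induction x arbitrary: b f g)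
    case (BGen n)
    then show ?case by (auto simp: raise pairing_lower_op fin)
  next
    case (BPlus x y)
    then show ?case by (simp add: pairing_add pairing_add_right fin dom)
  next
    case (BScale c x)
    then show ?case by (simp add: pairing_scale pairing_scale_right fin dom)
  qed (auto simp: pairing_def supp_def dom)
qed

section \<open>Boson actions on spans of orthogonal families\<close>

text \<open>A change of a single entry is a chain of unit steps, so the finitely many entries where
  m differs from k can be corrected one after the other.\<close>

lemma near_induct [consumes 1, case_names base raise lower]:
  assumes "m \<in> near k"
    and base: "P k"
    and raise: "\<And>m n. m \<in> near k \<Longrightarrow> P m \<Longrightarrow> P (m(n := Suc (m n)))"
    and lower: "\<And>m n. m \<in> near k \<Longrightarrow> P m \<Longrightarrow> m n \<noteq> 0 \<Longrightarrow> P (m(n := m n - 1))"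
  shows "P m"
proof -
  \<comment> \<open>With raising and lowering both available, P is constant in the entry at n; the
    value 0 is a common reference point for all p.\<close>
  have step: "P (m(n := p)) \<longleftrightarrow> P (m(n := 0))" if "m \<in> near k" for m n p
  proof (induction p)
    case (Suc p)
    have "P (m(n := p)) \<longleftrightarrow> P (m(n := Suc p))"
      using raise[of "m(n := p)" n, unfolded fun_upd_upd fun_upd_same near_upd_iff]
        lower[of "m(n := Suc p)" n, unfolded fun_upd_upd fun_upd_same near_upd_iff diff_Suc_1]
        that Suc_not_Zero[of p] by blast
    then show ?case using Suc by blast
  qed simp
  have move: "P (m(n := p))" if "m \<in> near k" "P m" for m n p
    using step[OF that(1), of n p] step[OF that(1), of n "m n"] that(2) by simp
  have "P m" if "finite A" "{n. m n \<noteq> k n} = A" for A m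
    using that
  proof (induction A arbitrary: m)
    case empty
    then have "m = k" by auto
    then show ?case using base by simp
  next
    case (insert a A)
    let ?m = "m(a := k a)"
    have "{n. ?m n \<noteq> k n} = A" using insert.hyps(2) insert.prems by auto
    then have "P ?m" "?m \<in> near k" using insert.IH insert.hyps(1) by (auto simp: near_def)
    then have "P (?m(a := m a))" using move by blast
    then show ?case by simp
  qed
  then show ?thesis using assms(1) by (simp add: near_def)
qed

definition unit_fun :: "(nat \<Rightarrow> nat) \<Rightarrow> occ_fun" where
  "unit_fun m = (\<lambda>m'. if m' = m then 1 else 0)"

lemma supp_unit_fun [simp]: "supp (unit_fun m) = {m}"
  by (auto simp: supp_def unit_fun_def)

lemma unit_fun_in_fock_domain [simp]: "m \<in> near k \<Longrightarrow> unit_fun m \<in> fock_domain k"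
  by (simp add: fock_domain_def)

lemma raise_op_unit_fun:
  "raise_op n (unit_fun m) = (\<lambda>m'. complex_of_real (sqrt (Suc (m n))) * unit_fun (m(n := Suc (m n))) m')"
  by (auto simp: fun_eq_iff raise_op_def unit_fun_def split: if_splits)

lemma lower_op_unit_fun:
  "m n \<noteq> 0 \<Longrightarrow>
    lower_op n (unit_fun m) = (\<lambda>m'. complex_of_real (sqrt (m n)) * unit_fun (m(n := m n - 1)) m')"
  by (auto simp: fun_eq_iff lower_op_def unit_fun_def split: if_splits)

text \<open>The common squared norm r need not be 1 because the cyclic vector is not
  normalised.\<close>

locale occupation_family =
  fixes k :: "nat \<Rightarrow> nat" and e :: "(nat \<Rightarrow> nat) \<Rightarrow> 'h::complex_hilbert_space" and r :: real
  assumes r_pos: "0 < r"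
    and orthogonal: "m \<in> near k \<Longrightarrow> m' \<in> near k \<Longrightarrow>
      cinner (e m) (e m') = (if m = m' then complex_of_real r else 0)"
begin

definition vec :: "occ_fun \<Rightarrow> 'h" where
  "vec f = (\<Sum>m\<in>supp f. f m *\<^sub>C e m)"

text \<open>Off \<open>near k\<close> nothing is known about e. The value 0 there makes
  \<open>coord\<close> an exact left inverse of \<open>vec\<close> on
  \<open>fock_domain k\<close>.\<close>

definition coord :: "'h \<Rightarrow> occ_fun" where
  "coord u m = (if m \<in> near k then cinner (e m) u / complex_of_real r else 0)"

definition dom :: "'h set" where
  "dom = vec ` fock_domain k"

definition act :: "boson \<Rightarrow> 'h \<Rightarrow> 'h" where
  "act x u = vec (fock_act x False (coord u))"

lemma vec_superset: "finite A \<Longrightarrow> supp f \<subseteq> A \<Longrightarrow> vec f = (\<Sum>m\<in>A. f m *\<^sub>C e m)"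
  unfolding vec_def by (rule sum.mono_neutral_left) (auto simp: supp_def)

lemma vec_add:
  assumes "f \<in> fock_domain k" "g \<in> fock_domain k"
  shows "vec (\<lambda>m. f m + g m) = vec f + vec g"
proof -
  have "supp (\<lambda>m. f m + g m) \<subseteq> supp f \<union> supp g" by (auto simp: supp_def)
  then show ?thesis
    using assms
    by (simp add: vec_superset[of "supp f \<union> supp g"] sum.distrib scaleC_add_left fock_domain_def)
qed

lemma vec_scale:
  assumes "f \<in> fock_domain k"
  shows "vec (\<lambda>m. c * f m) = c *\<^sub>C vec f"
proof -
  have "supp (\<lambda>m. c * f m) \<subseteq> supp f" by (auto simp: supp_def)
  then show ?thesis
    using assms by (simp add: vec_superset[of "supp f"] cvec.scale_sum_right fock_domain_def)
qed

lemma coord_vec: "f \<in> fock_domain k \<Longrightarrow> coord (vec f) = f"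
proof
  fix m assume f: "f \<in> fock_domain k"
  show "coord (vec f) m = f m"
  proof (cases "m \<in> near k")
    case True
    have "cinner (e m) (vec f) = (\<Sum>m'\<in>supp f. if m = m' then f m' * complex_of_real r else 0)"
      using f True unfolding vec_def cinner_sum_right cinner_scaleC_right
      by (intro sum.cong) (auto simp: orthogonal fock_domain_def)
    also have "\<dots> = f m * complex_of_real r"
      using f by (simp add: fock_domain_def sum.delta' supp_def)
    finally show ?thesis using r_pos True by (simp add: coord_def)
  next
    case False
    then show ?thesis using f by (auto simp: coord_def fock_domain_def supp_def)
  qed
qed

lemma cinner_vec:
  assumes "f \<in> fock_domain k" "g \<in> fock_domain k"
  shows "cinner (vec f) (vec g) = complex_of_real r * pairing f g"
proof -
  have "cinner (e m) (vec g) = complex_of_real r * g m" if "m \<in> near k" for m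
    using fun_cong[OF coord_vec[OF assms(2)], of m] that r_pos by (simp add: coord_def field_simps)
  then have "cinner (vec f) (vec g) = (\<Sum>m\<in>supp f. cnj (f m) * (complex_of_real r * g m))"
    using assms(1) unfolding vec_def[of f] cinner_sum_left cinner_scaleC_left
    by (intro sum.cong) (auto simp: fock_domain_def)
  then show ?thesis by (simp add: pairing_def sum_distrib_left mult_ac)
qed

lemma act_vec: "f \<in> fock_domain k \<Longrightarrow> act x (vec f) = vec (fock_act x False f)"
  by (simp add: act_def coord_vec)

lemma vec_unit_fun: "vec (unit_fun m) = e m"
  by (simp add: vec_def) (simp add: unit_fun_def)

lemma e_in_dom: "m \<in> near k \<Longrightarrow> e m \<in> dom"
  unfolding dom_def by (metis imageI unit_fun_in_fock_domain vec_unit_fun)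

lemma csubspace_dom: "csubspace dom"
  unfolding csubspace_def
proof (intro conjI ballI allI)
  have "(\<lambda>_. 0) \<in> fock_domain k" by (simp add: fock_domain_def supp_def)
  moreover have "vec (\<lambda>_. 0) = 0" by (simp add: vec_def)
  ultimately show "0 \<in> dom" unfolding dom_def by force
next
  fix u v assume "u \<in> dom" "v \<in> dom"
  then show "u + v \<in> dom"
    by (auto simp: dom_def vec_add[symmetric] fock_domain_add)
next
  fix c u assume "u \<in> dom"
  then show "c *\<^sub>C u \<in> dom"
    by (auto simp: dom_def vec_scale[symmetric] fock_domain_scale)
qed

lemma clinear_act: "clinear_into dom dom (act x)"
  unfolding clinear_into_def dom_def
  by (auto simp: act_vec fock_domain_fock_act vec_add[symmetric] vec_scale[symmetric]
      fock_domain_add fock_domain_scale fock_act_add fock_act_scale)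

lemma adjoint_act: "adjoint_on dom (act x) (act (x\<^sup>\<star>))"
  unfolding adjoint_on_def dom_def
  by (auto simp: act_vec fock_domain_fock_act cinner_vec fock_act_simps pairing_fock_act)

theorem boson_action_act: "boson_action dom act"
  unfolding boson_action_def
proof (intro conjI allI ballI)
  show "csubspace dom" by (rule csubspace_dom)
  show "act x \<in> adjointable_endos dom" for x
    unfolding adjointable_endos_def using clinear_act adjoint_act by blast
  show "adjoint_on dom (act x) (act (x\<^sup>\<star>))" for x by (rule adjoint_act)
qed (auto simp: dom_def act_vec fock_act_simps fock_domain_fock_act vec_add vec_scale)

lemma act_ann:
  "m \<in> near k \<Longrightarrow> m n \<noteq> 0 \<Longrightarrow>
    act (ann (Suc n)) (e m) = complex_of_real (sqrt (m n)) *\<^sub>C e (m(n := m n - 1))"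
  by (simp add: vec_unit_fun[symmetric] act_vec fock_act_simps lower_op_unit_fun vec_scale)

lemma act_cre:
  "m \<in> near k \<Longrightarrow>
    act ((ann (Suc n))\<^sup>\<star>) (e m) = complex_of_real (sqrt (Suc (m n))) *\<^sub>C e (m(n := Suc (m n)))"
  by (simp add: vec_unit_fun[symmetric] act_vec fock_act_simps raise_op_unit_fun vec_scale
      del: of_nat_Suc)

lemma act_number:
  assumes "m \<in> near k"
  shows "act ((ann (Suc n))\<^sup>\<star> * ann (Suc n)) (e m) = of_nat (m n) *\<^sub>C e m"
proof -
  have "raise_op n (lower_op n (unit_fun m)) = (\<lambda>m'. of_nat (m n) * unit_fun m m')"
    by (auto simp: fun_eq_iff raise_op_lower_op_same unit_fun_def)
  then show ?thesis
    using assms by (simp add: vec_unit_fun[symmetric] act_vec fock_act_simps vec_scale)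
qed

lemma act_antinumber:
  assumes "m \<in> near k"
  shows "act (ann (Suc n) * (ann (Suc n))\<^sup>\<star>) (e m) = of_nat (Suc (m n)) *\<^sub>C e m"
proof -
  have "lower_op n (raise_op n (unit_fun m)) = (\<lambda>m'. of_nat (Suc (m n)) * unit_fun m m')"
    by (auto simp: fun_eq_iff lower_op_raise_op_same unit_fun_def)
  then show ?thesis
    using assms
    by (simp add: vec_unit_fun[symmetric] act_vec fock_act_simps vec_scale del: of_nat_Suc)
qed

text \<open>Unit steps lead from k to every sequence near it, and each step multiplies by the square
  root of a positive number, which can be divided out.\<close>

theorem boson_cyclic_act: "boson_cyclic dom act (e k)"
proof -
  define R where "R = range (\<lambda>x. act x (e k))"
  have add: "act (x + y) u = act x u + act y u" and sc: "act (c *\<^sub>C x) u = c *\<^sub>C act x u"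
    and mu: "act (x * y) u = act x (act y u)" and one: "act 1 u = u"
    if "u \<in> dom" for x y c u
    using boson_action_act that by (auto simp: boson_action_def)
  have ek: "e k \<in> dom" by (simp add: e_in_dom)
  have Radd: "u + v \<in> R" if "u \<in> R" "v \<in> R" for u v
    using that by (auto simp: R_def add[OF ek, symmetric])
  have Rsc: "c *\<^sub>C u \<in> R" if "u \<in> R" for u c
    using that by (auto simp: R_def sc[OF ek, symmetric])
  have Rmu: "act x u \<in> R" if "u \<in> R" for u x
    using that by (auto simp: R_def mu[OF ek, symmetric])
  have Re: "e m \<in> R" if "m \<in> near k" for m
    using that
  proof (induction rule: near_induct)
    case base
    show ?case unfolding R_def using one[OF ek] by (metis rangeI)
  next
    case (raise m n)
    let ?c = "complex_of_real (sqrt (Suc (m n)))"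
    have "e (m(n := Suc (m n))) = (1 / ?c) *\<^sub>C act ((ann (Suc n))\<^sup>\<star>) (e m)"
      using raise(1) by (simp add: act_cre scaleC_one del: of_nat_Suc)
    then show ?case using raise(2) Rmu Rsc by metis
  next
    case (lower m n)
    let ?c = "complex_of_real (sqrt (m n))"
    have "e (m(n := m n - 1)) = (1 / ?c) *\<^sub>C act (ann (Suc n)) (e m)"
      using lower(1,2) by (simp add: act_ann scaleC_one)
    then show ?case using lower(3) Rmu Rsc by metis
  qed
  have R0: "0 \<in> R" using Rsc[OF Re[OF near_refl], of 0] by simp
  have "(\<Sum>m\<in>A. f m *\<^sub>C e m) \<in> R" if "A \<subseteq> near k" "finite A" for A and f :: occ_fun
    using that(2,1) by (induction A) (auto intro!: Radd Rsc Re R0)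
  then have "dom \<subseteq> R"
    by (auto simp: dom_def vec_def fock_domain_def)
  moreover have "R \<subseteq> dom"
    using clinear_act ek by (auto simp: R_def clinear_into_def)
  ultimately show ?thesis using ek by (auto simp: boson_cyclic_def R_def)
qed

end

section \<open>Cyclic vectors with given occupation numbers\<close>

text \<open>Structural induction on representing terms; \<open>BGen n\<close> represents
  \<open>ann (Suc n)\<close>, so positive indices reach every generator.\<close>

lemma boson_induct [case_names ann one zero add mult scale star]:
  assumes "\<And>n. P (ann (Suc n))" "P 1" "P 0"
    and "\<And>x y. P x \<Longrightarrow> P y \<Longrightarrow> P (x + y)" "\<And>x y. P x \<Longrightarrow> P y \<Longrightarrow> P (x * y)"
    and "\<And>c x. P x \<Longrightarrow> P (c *\<^sub>C x)" "\<And>x. P x \<Longrightarrow> P (x\<^sup>\<star>)"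
  shows "P x"
proof (induction x rule: boson.abs_induct)
  fix t
  show "P (abs_boson t)"
  proof (induction t)
    case (BGen n)
    show ?case using assms(1)[of n] by (simp add: ann.abs_eq)
  qed (use assms in \<open>auto simp: zero_boson.abs_eq one_boson.abs_eq plus_boson.abs_eq[symmetric]
      times_boson.abs_eq[symmetric] scaleC_boson.abs_eq[symmetric] star_boson.abs_eq[symmetric]\<close>)
qed

lemma zero_of_closure_orthogonal:
  fixes w :: "'a::complex_hilbert_space"
  assumes "w \<in> closure D" "\<And>v. v \<in> D \<Longrightarrow> cinner w v = 0"
  shows "w = 0"
  using closure_orthogonal[OF assms(2,1)] by simp

lemma csubspace_orthogonal: "csubspace {v :: 'a::complex_hilbert_space. cinner u v = 0}"
  by (simp add: csubspace_def cinner_add_right cinner_scaleC_right)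

text \<open>Inequivalence and irreducibility are claimed for all actions that fit the description,
  so these assumptions replace the construction by words.\<close>

locale occupation_state =
  fixes k :: "nat \<Rightarrow> nat" and D :: "'h::complex_hilbert_space set"
    and \<eta> :: "boson \<Rightarrow> 'h \<Rightarrow> 'h" and \<omega> :: 'h
  assumes action: "boson_action D \<eta>" and cyclic: "boson_cyclic D \<eta> \<omega>" and nonzero: "\<omega> \<noteq> 0"
    and number: "\<eta> ((ann (Suc n))\<^sup>\<star> * ann (Suc n)) \<omega> = of_nat (k n) *\<^sub>C \<omega>"
begin

definition an :: "nat \<Rightarrow> 'h \<Rightarrow> 'h" where "an n = \<eta> (ann (Suc n))"
definition cr :: "nat \<Rightarrow> 'h \<Rightarrow> 'h" where "cr n = \<eta> ((ann (Suc n))\<^sup>\<star>)"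

lemma subspace_D: "cvec.subspace D"
  using action by (simp add: boson_action_def csubspace_iff_subspace)

lemma omega_in_D: "\<omega> \<in> D"
  using cyclic by (simp add: boson_cyclic_def)

lemma closed: "u \<in> D \<Longrightarrow> \<eta> x u \<in> D"
  using action by (auto simp: boson_action_def adjointable_endos_def clinear_into_def)

lemma linear_add: "u \<in> D \<Longrightarrow> v \<in> D \<Longrightarrow> \<eta> x (u + v) = \<eta> x u + \<eta> x v"
  using action by (auto simp: boson_action_def adjointable_endos_def clinear_into_def)

lemma linear_scale: "u \<in> D \<Longrightarrow> \<eta> x (c *\<^sub>C u) = c *\<^sub>C \<eta> x u"
  using action by (auto simp: boson_action_def adjointable_endos_def clinear_into_def)

lemma hom:
  assumes "u \<in> D"
  shows "\<eta> (x + y) u = \<eta> x u + \<eta> y u" "\<eta> (c *\<^sub>C x) u = c *\<^sub>C \<eta> x u"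
    "\<eta> (x * y) u = \<eta> x (\<eta> y u)" "\<eta> 1 u = u"
  using action assms by (auto simp: boson_action_def)

lemma hom_zero: "u \<in> D \<Longrightarrow> \<eta> 0 u = 0"
  using hom(2)[of u 0 0] by simp

lemma adjoint: "u \<in> D \<Longrightarrow> v \<in> D \<Longrightarrow> cinner (\<eta> x u) v = cinner u (\<eta> (x\<^sup>\<star>) v)"
  using action by (simp add: boson_action_def adjoint_on_def)

lemma an_D [simp]: "u \<in> D \<Longrightarrow> an n u \<in> D" and cr_D [simp]: "u \<in> D \<Longrightarrow> cr n u \<in> D"
  by (simp_all add: an_def cr_def closed)

lemma scale_D [simp]: "u \<in> D \<Longrightarrow> c *\<^sub>C u \<in> D"
  using subspace_D by (simp add: cvec.subspace_scale)

lemma an_cr: "u \<in> D \<Longrightarrow> an n (cr l u) = cr l (an n u) + (if n = l then u else 0)"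
proof -
  assume u: "u \<in> D"
  have "ann (Suc n) * (ann (Suc l))\<^sup>\<star> = (ann (Suc l))\<^sup>\<star> * ann (Suc n) + (if n = l then 1 else 0)"
    using ann_ccr[of "Suc n" "Suc l"] by (simp add: algebra_simps)
  then have "\<eta> (ann (Suc n) * (ann (Suc l))\<^sup>\<star>) u
      = \<eta> ((ann (Suc l))\<^sup>\<star> * ann (Suc n)) u + \<eta> (if n = l then 1 else 0) u"
    using u by (simp only: hom)
  then show ?thesis using u by (auto simp: hom hom_zero an_def cr_def)
qed

lemma an_an: "u \<in> D \<Longrightarrow> an n (an l u) = an l (an n u)"
  using ann_commute[of "Suc n" "Suc l"] by (simp add: an_def hom(3)[symmetric])

lemma cr_cr: "u \<in> D \<Longrightarrow> cr n (cr l u) = cr l (cr n u)"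
  using cre_commute[of "Suc n" "Suc l"] by (simp add: cr_def hom(3)[symmetric])

lemma linear_cr:
  "u \<in> D \<Longrightarrow> v \<in> D \<Longrightarrow> cr n (u + v) = cr n u + cr n v"
  "u \<in> D \<Longrightarrow> cr n (c *\<^sub>C u) = c *\<^sub>C cr n u"
  "u \<in> D \<Longrightarrow> v \<in> D \<Longrightarrow> an n (u + v) = an n u + an n v"
  "u \<in> D \<Longrightarrow> an n (c *\<^sub>C u) = c *\<^sub>C an n u"
  by (simp_all add: an_def cr_def linear_add linear_scale)

lemma eta_number: "u \<in> D \<Longrightarrow> \<eta> ((ann (Suc n))\<^sup>\<star> * ann (Suc n)) u = cr n (an n u)"
  by (simp add: an_def cr_def hom)

text \<open>The squared norm of \<open>an n u\<close> is the inner product of u with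
  \<open>cr n (an n u)\<close>. In particular, occupation number 0 means annihilation.\<close>

lemma an_eq_zero:
  assumes "u \<in> D" "cr n (an n u) = 0"
  shows "an n u = 0"
proof -
  have "cinner (an n u) (an n u) = cinner u (cr n (an n u))"
    using assms(1) adjoint[of u "an n u" "ann (Suc n)"] by (simp add: an_def cr_def closed)
  then show ?thesis using assms(2) by simp
qed

text \<open>Each step moves an occupation number away from its reference value, so that the only
  vector with the occupation numbers k is \<open>\<omega>\<close> itself.\<close>

inductive monomial :: "(nat \<Rightarrow> nat) \<Rightarrow> 'h \<Rightarrow> bool" where
  base: "monomial k \<omega>"
| up: "monomial m v \<Longrightarrow> k n \<le> m n \<Longrightarrow> monomial (m(n := Suc (m n))) (cr n v)"
| down: "monomial m v \<Longrightarrow> m n \<le> k n \<Longrightarrow> m n \<noteq> 0 \<Longrightarrow> monomial (m(n := m n - 1)) (an n v)"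

lemma monomial_D: "monomial m v \<Longrightarrow> v \<in> D"
  by (induction rule: monomial.induct) (simp_all add: omega_in_D)

lemma monomial_near: "monomial m v \<Longrightarrow> m \<in> near k"
  by (induction rule: monomial.induct) (simp_all only: near_refl near_upd_iff)

text \<open>A last step up or down at n leaves the entry at n strictly above or strictly below k n,
  so only the rule \<open>base\<close> can end at k.\<close>

lemma monomial_base: "monomial k v \<Longrightarrow> v = \<omega>"
proof -
  have "m = k \<Longrightarrow> v = \<omega>" if "monomial m v" for m v
    using that by (cases rule: monomial.cases) (auto dest!: fun_cong)
  then show "monomial k v \<Longrightarrow> v = \<omega>" by blast
qed

text \<open>Commuting a number operator past a creation or annihilation operator at the same
  position shifts the eigenvalue by one; at other positions it changes nothing.\<close>

lemma monomial_number: "monomial m v \<Longrightarrow> cr l (an l v) = of_nat (m l) *\<^sub>C v"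
proof (induction rule: monomial.induct)
  case base
  show ?case using number[of l] omega_in_D by (simp add: eta_number)
next
  case (up m v n)
  have v: "v \<in> D" using up.hyps(1) by (rule monomial_D)
  have "cr l (an l (cr n v)) = cr n (cr l (an l v)) + (if l = n then cr n v else 0)"
    using v by (auto simp: an_cr linear_cr cr_cr[of _ l n])
  also have "\<dots> = of_nat ((m(n := Suc (m n))) l) *\<^sub>C cr n v"
    using v by (auto simp: up.IH linear_cr scaleC_add_left scaleC_one)
  finally show ?case .
next
  case (down m v n)
  have v: "v \<in> D" using down.hyps(1) by (rule monomial_D)
  have "an n (cr l (an l v)) = cr l (an l (an n v)) + (if l = n then an n v else 0)"
    using v by (auto simp: an_cr an_an[of _ l n])
  moreover have "an n (cr l (an l v)) = of_nat (m l) *\<^sub>C an n v"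
    using v by (simp add: down.IH linear_cr)
  ultimately have "cr l (an l (an n v)) = of_nat (m l) *\<^sub>C an n v - (if l = n then 1 *\<^sub>C an n v else 0)"
    by (simp add: scaleC_one)
  also have "\<dots> = of_nat ((m(n := m n - 1)) l) *\<^sub>C an n v"
    using down.hyps(3) by (simp add: of_nat_diff cvec.scale_left_diff_distrib)
  finally show ?case .
qed

text \<open>An entry above k n must come from a step up at n, and operators at different positions
  commute, so that step can be moved to the front. There an annihilation operator can cancel
  it.\<close>

lemma monomial_up_inverse:
  "monomial m v \<Longrightarrow> k n < m n \<Longrightarrow> \<exists>v'. monomial (m(n := m n - 1)) v' \<and> v = cr n v'"
proof (induction rule: monomial.induct)
  case (up m v l)
  show ?case
  proof (cases "l = n")
    case True
    then show ?thesis
      using up.hyps(1) unfolding True fun_upd_upd fun_upd_same diff_Suc_1 fun_upd_triv by blast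
  next
    case False
    then obtain v' where v': "monomial (m(n := m n - 1)) v'" "v = cr n v'"
      using up.IH up.prems unfolding fun_upd_other[OF False[symmetric]] by blast
    have "monomial ((m(n := m n - 1))(l := Suc (m l))) (cr l v')"
      using monomial.up[OF v'(1), of l] False up.hyps(2) by simp
    then have "monomial ((m(l := Suc (m l)))(n := (m(l := Suc (m l))) n - 1)) (cr l v')"
      unfolding fun_upd_other[OF False[symmetric]] fun_upd_twist[OF False] .
    moreover have "cr l v = cr n (cr l v')"
      using False v' monomial_D[OF v'(1)] by (simp add: an_cr an_an[of _ l n] cr_cr[of _ l n])
    ultimately show ?thesis by blast
  qed
next
  case (down m v l)
  show ?case
  proof (cases "l = n")
    case True
    then show ?thesis using down.hyps down.prems by simp
  next
    case False
    then obtain v' where v': "monomial (m(n := m n - 1)) v'" "v = cr n v'"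
      using down.IH down.prems unfolding fun_upd_other[OF False[symmetric]] by blast
    have "monomial ((m(n := m n - 1))(l := m l - 1)) (an l v')"
      using monomial.down[OF v'(1), of l] False down.hyps(2,3) by simp
    then have "monomial ((m(l := m l - 1))(n := (m(l := m l - 1)) n - 1)) (an l v')"
      unfolding fun_upd_other[OF False[symmetric]] fun_upd_twist[OF False] .
    moreover have "an l v = cr n (an l v')"
      using False v' monomial_D[OF v'(1)] by (simp add: an_cr an_an[of _ l n] cr_cr[of _ l n])
    ultimately show ?thesis by blast
  qed
qed simp

text \<open>The mirror image: a step down at n is moved to the front, where a creation operator
  turns it into a number operator.\<close>

lemma monomial_down_inverse:
  "monomial m v \<Longrightarrow> m n < k n \<Longrightarrow> \<exists>v'. monomial (m(n := Suc (m n))) v' \<and> v = an n v'"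
proof (induction rule: monomial.induct)
  case (up m v l)
  show ?case
  proof (cases "l = n")
    case True
    then show ?thesis using up.hyps up.prems by simp
  next
    case False
    then obtain v' where v': "monomial (m(n := Suc (m n))) v'" "v = an n v'"
      using up.IH up.prems unfolding fun_upd_other[OF False[symmetric]] by blast
    have "monomial ((m(n := Suc (m n)))(l := Suc (m l))) (cr l v')"
      using monomial.up[OF v'(1), of l] False up.hyps(2) by simp
    then have "monomial ((m(l := Suc (m l)))(n := Suc ((m(l := Suc (m l))) n))) (cr l v')"
      unfolding fun_upd_other[OF False[symmetric]] fun_upd_twist[OF False] .
    moreover have "cr l v = an n (cr l v')"
      using False v' monomial_D[OF v'(1)] by (simp add: an_cr an_an[of _ l n] cr_cr[of _ l n])
    ultimately show ?thesis by blast
  qed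
next
  case (down m v l)
  show ?case
  proof (cases "l = n")
    case True
    then show ?thesis
      using down.hyps
      unfolding True fun_upd_upd fun_upd_same fun_upd_triv Suc_diff_1[OF down.hyps(3)[unfolded True neq0_conv]]
      by auto
  next
    case False
    then obtain v' where v': "monomial (m(n := Suc (m n))) v'" "v = an n v'"
      using down.IH down.prems unfolding fun_upd_other[OF False[symmetric]] by blast
    have "monomial ((m(n := Suc (m n)))(l := m l - 1)) (an l v')"
      using monomial.down[OF v'(1), of l] False down.hyps(2,3) by simp
    then have "monomial ((m(l := m l - 1))(n := Suc ((m(l := m l - 1)) n))) (an l v')"
      unfolding fun_upd_other[OF False[symmetric]] fun_upd_twist[OF False] .
    moreover have "an l v = an n (an l v')"
      using False v' monomial_D[OF v'(1)] by (simp add: an_cr an_an[of _ l n] cr_cr[of _ l n])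
    ultimately show ?thesis by blast
  qed
qed simp

section \<open>The monomials span the domain\<close>

definition monomial_span :: "'h set" where
  "monomial_span = cvec.span {v. \<exists>m. monomial m v}"

lemma monomial_in_span: "monomial m v \<Longrightarrow> v \<in> monomial_span"
  unfolding monomial_span_def by (rule cvec.span_base) auto

lemma monomial_cr: "monomial m v \<Longrightarrow> cr n v \<in> monomial_span"
proof (cases "k n \<le> m n")
  case True
  then show "monomial m v \<Longrightarrow> cr n v \<in> monomial_span"
    using monomial.up monomial_in_span by blast
next
  case False
  assume "monomial m v"
  \<comment> \<open>A step back towards k: \<open>cr n v\<close> is the number operator at n applied
    to v', hence a multiple of v'.\<close>
  with False obtain v' where v': "monomial (m(n := Suc (m n))) v'" "v = an n v'"
    using monomial_down_inverse[of m v n] by auto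
  then show "cr n v \<in> monomial_span"
    using monomial_number[OF v'(1), of n] monomial_in_span[OF v'(1)]
    by (simp add: monomial_span_def cvec.span_scale)
qed

lemma monomial_an: "monomial m v \<Longrightarrow> an n v \<in> monomial_span"
proof -
  assume mv: "monomial m v"
  consider "m n = 0" | "m n \<noteq> 0" "m n \<le> k n" | "k n < m n" by linarith
  then show ?thesis
  proof cases
    case 1
    \<comment> \<open>No rule lowers an entry 0. Here positivity is needed: the number operator at n
      kills v, hence so does annihilation.\<close>
    then have "an n v = 0"
      using monomial_number[OF mv, of n] monomial_D[OF mv] by (intro an_eq_zero) auto
    then show ?thesis by (simp add: monomial_span_def cvec.span_zero)
  next
    case 2
    then show ?thesis using monomial.down[OF mv, of n] monomial_in_span by blast
  next
    case 3
    then obtain v' where v': "monomial (m(n := m n - 1)) v'" "v = cr n v'"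
      using monomial_up_inverse[OF mv] by blast
    have "v' \<in> D" using v'(1) by (rule monomial_D)
    \<comment> \<open>A step back towards k: exchanging \<open>an n\<close> and \<open>cr n\<close>
      gives the number operator on v' plus the identity.\<close>
    then have "an n v = of_nat (m n - 1) *\<^sub>C v' + v'"
      using monomial_number[OF v'(1), of n] v'(2) by (simp add: an_cr)
    then show ?thesis
      using monomial_in_span[OF v'(1)]
      by (simp add: monomial_span_def cvec.span_scale cvec.span_add)
  qed
qed

lemma monomial_span_subset_D: "monomial_span \<subseteq> D"
  unfolding monomial_span_def
  by (rule cvec.span_minimal) (auto simp: subspace_D monomial_D)

lemma monomial_span_invariant:
  assumes "u \<in> monomial_span"
  shows "an n u \<in> monomial_span" "cr n u \<in> monomial_span"
proof -
  let ?L = "{u \<in> D. an n u \<in> monomial_span \<and> cr n u \<in> monomial_span}"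
  have "cvec.subspace ?L"
  proof (rule cvec.subspaceI)
    have "an n 0 = 0" "cr n 0 = 0"
      using linear_cr(2,4)[OF omega_in_D, of n 0] by simp_all
    then show "0 \<in> ?L"
      using cvec.subspace_0[OF subspace_D] by (simp add: monomial_span_def cvec.span_zero)
  next
    fix u v assume "u \<in> ?L" "v \<in> ?L"
    then show "u + v \<in> ?L"
      using cvec.subspace_add[OF subspace_D]
      by (simp add: linear_cr monomial_span_def cvec.span_add)
  next
    fix c u assume "u \<in> ?L"
    then show "c *\<^sub>C u \<in> ?L"
      by (simp add: linear_cr monomial_span_def cvec.span_scale)
  qed
  then have "cvec.span {v. \<exists>m. monomial m v} \<subseteq> ?L"
    by (intro cvec.span_minimal) (auto simp: monomial_D monomial_an monomial_cr)
  then have "u \<in> ?L" using assms unfolding monomial_span_def by blast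
  then show "an n u \<in> monomial_span" "cr n u \<in> monomial_span" by auto
qed

lemma D_eq_monomial_span: "D = monomial_span"
proof
  \<comment> \<open>Carrying x and its adjoint together lets the case of a star merely exchange the
    two claims.\<close>
  have "\<forall>u\<in>monomial_span. \<eta> x u \<in> monomial_span \<and> \<eta> (x\<^sup>\<star>) u \<in> monomial_span" for x
  proof (induction x rule: boson_induct)
    case (ann n)
    then show ?case using monomial_span_invariant[of _ n] by (simp add: an_def cr_def)
  next
    case (add x y)
    then show ?case
      using monomial_span_subset_D by (auto simp: hom star_add monomial_span_def cvec.span_add)
  next
    case (mult x y)
    then show ?case
      using monomial_span_subset_D by (auto simp: hom star_mult)
  next
    case (scale c x)
    then show ?case
      using monomial_span_subset_D by (auto simp: hom star_scaleC monomial_span_def cvec.span_scale)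
  next
    case zero
    then show ?case
      using monomial_span_subset_D by (auto simp: hom_zero monomial_span_def cvec.span_zero)
  next
    case one
    then show ?case
      using monomial_span_subset_D by (auto simp: hom)
  next
    case (star x)
    then show ?case by (simp add: star_star)
  qed
  moreover have "\<omega> \<in> monomial_span" by (rule monomial_in_span[OF monomial.base])
  ultimately show "D \<subseteq> monomial_span"
    using cyclic by (auto simp: boson_cyclic_def)
qed (rule monomial_span_subset_D)

section \<open>Weak eigenvectors, the commutant and unitary equivalence\<close>

lemma orthogonal_D:
  assumes "\<And>m v. monomial m v \<Longrightarrow> cinner w v = 0" "u \<in> D"
  shows "cinner w u = 0"
proof -
  have "monomial_span \<subseteq> {u. cinner w u = 0}"
    unfolding monomial_span_def
    using csubspace_orthogonal[of w] assms(1)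
    by (intro cvec.span_minimal) (auto simp: csubspace_iff_subspace)
  then show ?thesis using assms(2) D_eq_monomial_span by blast
qed

text \<open>Eigenvectors of a symmetric operator for different eigenvalues are orthogonal; compare
  at a place where m and p differ. The eigenvalue equation for w is tested against D only, so w may
  lie outside D.\<close>

lemma eigenvector_orthogonal:
  assumes "\<And>n v. v \<in> D \<Longrightarrow> cinner w (cr n (an n v)) = of_nat (p n) * cinner w v"
    and "monomial m v" "m \<noteq> p"
  shows "cinner w v = 0"
proof -
  obtain n where "m n \<noteq> p n" using assms(3) by auto
  moreover have "of_nat (m n) * cinner w v = of_nat (p n) * cinner w v"
    using assms(1)[OF monomial_D[OF assms(2)], of n] monomial_number[OF assms(2), of n]
    by (simp add: cinner_scaleC_right)
  ultimately show ?thesis by simp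
qed

lemma number_adjoint:
  assumes "u \<in> D" "v \<in> D"
  shows "cinner u (cr n (an n v)) = cinner (cr n (an n u)) v"
  using adjoint[OF assms, of "(ann (Suc n))\<^sup>\<star> * ann (Suc n)"] assms
  by (simp add: star_mult star_star eta_number)

text \<open>The component w of \<open>T \<omega>\<close> orthogonal to \<omega> satisfies the weak
  eigenvalue equations for k. It is thus orthogonal to every monomial and vanishes. Cyclicity
  spreads the scalar to D, and boundedness of T to the closure.\<close>

theorem irreducible: "boson_irreducible D \<eta>"
  unfolding boson_irreducible_def
proof (rule ballI)
  fix T assume T: "T \<in> boson_commutant D \<eta>"
  have clo: "cvec.subspace (closure D)"
    using csubspace_closure subspace_D by (simp add: csubspace_iff_subspace)
  have DsubC: "u \<in> closure D" if "u \<in> D" for u using that closure_subset by blast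
  have Tclo: "\<And>u. u \<in> closure D \<Longrightarrow> T u \<in> closure D"
    and Tadd: "\<And>u v. u \<in> closure D \<Longrightarrow> v \<in> closure D \<Longrightarrow> T (u + v) = T u + T v"
    and Tsc: "\<And>u c. u \<in> closure D \<Longrightarrow> T (c *\<^sub>C u) = c *\<^sub>C T u"
    using T unfolding boson_commutant_def bounded_operator_on_def clinear_into_def by auto
  obtain M where M: "\<And>u. u \<in> closure D \<Longrightarrow> norm (T u) \<le> M * norm u"
    using T unfolding boson_commutant_def bounded_operator_on_def by blast
  have comm: "cinner (T (\<eta> x u)) v = cinner (T u) (\<eta> (x\<^sup>\<star>) v)" if "u \<in> D" "v \<in> D" for x u v
    using T that unfolding boson_commutant_def by auto
  note om = omega_in_D
  \<comment> \<open>The coefficient that makes w orthogonal to \<omega>; the conjugate appears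
    because \<open>cinner\<close> is antilinear in its first argument.\<close>
  define c where "c = cnj (cinner (T \<omega>) \<omega> / cinner \<omega> \<omega>)"
  define w where "w = T \<omega> - c *\<^sub>C \<omega>"
  have w: "w \<in> closure D"
    unfolding w_def using clo Tclo[OF DsubC[OF om]] DsubC[OF om]
    by (simp add: cvec.subspace_diff cvec.subspace_scale)
  have number_omega: "cr n (an n \<omega>) = of_nat (k n) *\<^sub>C \<omega>" for n
    by (rule monomial_number[OF monomial.base])
  have "cinner w v = 0" if "monomial m v" for m v
  proof (cases "m = k")
    case True
    then have "v = \<omega>" using that monomial_base by blast
    then show ?thesis
      using nonzero by (simp add: w_def cinner_diff_left cinner_scaleC_left c_def)
  next
    case False
    have "cinner w (cr n (an n v)) = of_nat (k n) * cinner w v" if "v \<in> D" for n v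
    proof -
      have "cinner (T \<omega>) (cr n (an n v)) = of_nat (k n) * cinner (T \<omega>) v"
        using comm[OF om that, of "(ann (Suc n))\<^sup>\<star> * ann (Suc n)"] om that DsubC[OF om]
        by (simp add: star_mult star_star eta_number number_omega Tsc cinner_scaleC_left)
      then show ?thesis
        using number_adjoint[OF om that, of n]
        by (simp add: w_def cinner_diff_left cinner_scaleC_left number_omega algebra_simps)
    qed
    then show ?thesis using eigenvector_orthogonal that False by blast
  qed
  then have "cinner w v = 0" if "v \<in> D" for v using orthogonal_D that by blast
  with w have "w = 0" by (rule zero_of_closure_orthogonal)
  then have T\<omega>: "T \<omega> = c *\<^sub>C \<omega>" by (simp add: w_def)
  have TD: "T u = c *\<^sub>C u" if u: "u \<in> D" for u
  proof -
    obtain x where x: "u = \<eta> x \<omega>" using u cyclic unfolding boson_cyclic_def by blast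
    \<comment> \<open>The commutant condition and the adjoint relation both move x over to v, which
      leaves the known value of T at \<omega>.\<close>
    have "cinner (T u - c *\<^sub>C u) v = 0" if "v \<in> D" for v
      using comm[OF om that, of x] adjoint[OF om that, of x]
      by (simp add: x T\<omega> cinner_diff_left cinner_scaleC_left)
    moreover have "T u - c *\<^sub>C u \<in> closure D"
      using u DsubC Tclo clo by (simp add: cvec.subspace_diff cvec.subspace_scale)
    ultimately have "T u - c *\<^sub>C u = 0" using zero_of_closure_orthogonal by blast
    then show ?thesis by simp
  qed
  have "T u = c *\<^sub>C u" if u: "u \<in> closure D" for u
  proof -
    obtain f where f: "\<forall>n. f n \<in> D" "f \<longlonglongrightarrow> u" using u by (auto simp: closure_sequential)
    have "(\<lambda>n. T (f n)) \<longlonglongrightarrow> T u"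
    proof (rule LIM_zero_cancel, rule Lim_null_comparison)
      show "\<forall>\<^sub>F n in sequentially. norm (T (f n) - T u) \<le> M * norm (f n - u)"
      proof (intro always_eventually allI)
        fix n
        have fn: "f n - u \<in> closure D"
          using f(1) DsubC u clo by (simp add: cvec.subspace_diff)
        then have "T (f n) = T (f n - u) + T u" using Tadd[OF fn u] by simp
        then show "norm (T (f n) - T u) \<le> M * norm (f n - u)" using M[OF fn] by simp
      qed
      show "(\<lambda>n. M * norm (f n - u)) \<longlonglongrightarrow> 0"
        using f(2) by (intro tendsto_mult_right_zero) (simp add: tendsto_norm_zero_iff LIM_zero_iff)
    qed
    moreover have "(\<lambda>n. T (f n)) \<longlonglongrightarrow> c *\<^sub>C u"
      using tendsto_scaleC[OF f(2), of c] f(1) by (simp add: TD)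
    ultimately show ?thesis by (rule LIMSEQ_unique)
  qed
  then show "\<exists>c. \<forall>u\<in>closure D. T u = c *\<^sub>C u" by blast
qed

end

text \<open>The image of \<omega> is a nonzero vector of E with the occupation numbers k. All
  monomials of E have occupation numbers near l, so if k were not among these the image would be
  orthogonal to all of E, itself included.\<close>

theorem equivalent_imp_near:
  assumes "occupation_state k D \<eta> \<omega>" "occupation_state l E \<theta> \<psi>"
    and "boson_unitarily_equivalent D \<eta> E \<theta>"
  shows "k \<in> near l"
proof (rule ccontr)
  assume far: "k \<notin> near l"
  interpret D: occupation_state k D \<eta> \<omega> by (rule assms(1))
  interpret E: occupation_state l E \<theta> \<psi> by (rule assms(2))
  obtain U where U: "unitary_between (closure D) (closure E) U" "U ` D = E"
      "\<And>x u. u \<in> D \<Longrightarrow> U (\<eta> x u) = \<theta> x (U u)"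
    using assms(3) unfolding boson_unitarily_equivalent_def by auto
  note om = D.omega_in_D
  have om': "\<omega> \<in> closure D" using om closure_subset by blast
  define w where "w = U \<omega>"
  have wE: "w \<in> E" using om U(2) by (auto simp: w_def)
  have "E.cr n (E.an n w) = of_nat (k n) *\<^sub>C w" for n
  proof -
    have "E.cr n (E.an n w) = U (of_nat (k n) *\<^sub>C \<omega>)"
      using U(3)[OF om, of "(ann (Suc n))\<^sup>\<star> * ann (Suc n)"] D.number[of n] E.eta_number[OF wE, of n] by (simp add: w_def)
    also have "\<dots> = of_nat (k n) *\<^sub>C w"
      using U(1) om' unfolding unitary_between_def clinear_into_def by (auto simp: w_def)
    finally show ?thesis .
  qed
  then have "cinner w (E.cr n (E.an n v)) = of_nat (k n) * cinner w v" if "v \<in> E" for n v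
    using E.number_adjoint[OF wE that, of n] by (simp add: cinner_scaleC_left)
  moreover have "m \<noteq> k" if "E.monomial m v" for m v
    using E.monomial_near[OF that] far by auto
  ultimately have "cinner w v = 0" if "E.monomial m v" for m v
    using E.eigenvector_orthogonal that by blast
  then have "cinner w w = 0" using E.orthogonal_D wE by blast
  moreover have "cinner w w = cinner \<omega> \<omega>"
    using U(1) om' unfolding unitary_between_def w_def by auto
  ultimately show False using D.nonzero by simp
qed

section \<open>Words in the isometries of the Cuntz algebra\<close>

lemma near_iff: "m \<in> near k \<longleftrightarrow> (\<exists>N. \<forall>i\<ge>N. m i = k i)"
proof
  assume "m \<in> near k"
  then obtain N where "\<forall>i\<in>{n. m n \<noteq> k n}. i < N"
    using finite_nat_bounded[of "{n. m n \<noteq> k n}"] by (auto simp: near_def)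
  then show "\<exists>N. \<forall>i\<ge>N. m i = k i" by (meson leD mem_Collect_eq)
next
  assume "\<exists>N. \<forall>i\<ge>N. m i = k i"
  then obtain N where N: "\<forall>i\<ge>N. m i = k i" by blast
  then have "{n. m n \<noteq> k n} \<subseteq> {..<N}" by (metis (mono_tags, lifting) lessThan_iff linorder_not_less mem_Collect_eq subsetI)
  then show "m \<in> near k" by (auto simp: near_def intro: finite_subset)
qed

locale cuntz_representation =
  fixes s :: "nat \<Rightarrow> 'o::cstar_algebra" and \<pi> :: "'o \<Rightarrow> 'h::complex_hilbert_space \<Rightarrow> 'h"
  assumes relations: "cuntz_relations s" and representation: "cstar_representation \<pi>"
begin

lemma rep:
  "\<pi> (x + y) u = \<pi> x u + \<pi> y u" "\<pi> (c *\<^sub>C x) u = c *\<^sub>C \<pi> x u"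
  "\<pi> (x * y) u = \<pi> x (\<pi> y u)" "\<pi> 1 u = u"
  "\<pi> x (u + v) = \<pi> x u + \<pi> x v" "\<pi> x (c *\<^sub>C u) = c *\<^sub>C \<pi> x u"
  using representation
  unfolding cstar_representation_def bounded_operator_on_def clinear_into_def by auto

lemma rep_zero [simp]: "\<pi> 0 u = 0" "\<pi> x 0 = 0"
  using rep(2)[of 0 0 u] rep(6)[of x 0 0] by simp_all

lemma rep_adjoint: "cinner (\<pi> x u) v = cinner u (\<pi> (x\<^sup>\<star>) v)"
  using representation unfolding cstar_representation_def by (metis star_star)

lemma isometries: "1 \<le> i \<Longrightarrow> 1 \<le> j \<Longrightarrow> \<pi> ((s i)\<^sup>\<star>) (\<pi> (s j) u) = (if i = j then u else 0)"
  using relations by (simp add: rep(3)[symmetric] cuntz_relations_def rep(4))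

lemma cinner_isometries:
  "1 \<le> i \<Longrightarrow> 1 \<le> j \<Longrightarrow> cinner (\<pi> (s i) u) (\<pi> (s j) v) = (if i = j then cinner u v else 0)"
  by (simp add: rep_adjoint isometries)

primrec word :: "nat list \<Rightarrow> 'h \<Rightarrow> 'h" where
  "word [] v = v"
| "word (i # J) v = \<pi> (s i) (word J v)"

lemma word_append: "word (J @ J') v = word J (word J' v)"
  by (induction J) simp_all

definition occ_word :: "nat \<Rightarrow> (nat \<Rightarrow> nat) \<Rightarrow> 'h \<Rightarrow> 'h" where
  "occ_word N m v = word (map (\<lambda>i. Suc (m i)) [0..<N]) v"

lemma occ_word_0 [simp]: "occ_word 0 m v = v"
  by (simp add: occ_word_def)

lemma occ_word_Suc: "occ_word (Suc N) m v = occ_word N m (\<pi> (s (Suc (m N))) v)"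
  by (simp add: occ_word_def word_append)

lemma occ_word_cong: "(\<And>i. i < N \<Longrightarrow> m i = m' i) \<Longrightarrow> occ_word N m v = occ_word N m' v"
  by (auto simp: occ_word_def intro!: arg_cong[where f = "\<lambda>J. word J v"])

lemma word_eq_occ_word:
  assumes "\<forall>i\<in>set J. 1 \<le> i"
  shows "word J v = occ_word (length J) (\<lambda>i. J ! i - 1) v"
proof -
  have "map (\<lambda>i. Suc (J ! i - 1)) [0..<length J] = J"
    using assms by (intro nth_equalityI) (auto simp: Suc_le_eq)
  then show ?thesis by (simp add: occ_word_def)
qed

lemma cinner_occ_word:
  "cinner (occ_word N m u) (occ_word N m' v) = (if \<forall>i<N. m i = m' i then cinner u v else 0)"
  by (induction N arbitrary: u v) (auto simp: occ_word_Suc cinner_isometries less_Suc_eq)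

text \<open>Every vector of T begins with an isometry applied to T, so even the empty word has a
  first letter for an adjoint to remove. The span is then stable under the generators and their
  adjoints. Contractivity passes from the dense star-subalgebra to the whole algebra.\<close>

lemma words_dense:
  assumes gen: "closure (star_subalgebra_gen s) = UNIV" and cyc: "cyclic_vector \<pi> \<Omega>"
    and \<Omega>: "\<Omega> \<in> T" and T: "\<And>t. t \<in> T \<Longrightarrow> \<exists>i\<ge>1. \<exists>t'\<in>T. t = \<pi> (s i) t'"
  shows "closure (cvec.span {word J t | J t. (\<forall>i\<in>set J. 1 \<le> i) \<and> t \<in> T}) = UNIV"
proof -
  define X where "X = {word J t | J t. (\<forall>i\<in>set J. 1 \<le> i) \<and> t \<in> T}"
  define Y where "Y = cvec.span X"
  have word_X: "word J t \<in> X" if "\<forall>i\<in>set J. 1 \<le> i" "t \<in> T" for J t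
    using that by (auto simp: X_def)
  have extend: "\<pi> x u \<in> Y" if "\<And>v. v \<in> X \<Longrightarrow> \<pi> x v \<in> Y" "u \<in> Y" for x u
  proof -
    have "cvec.subspace {u. \<pi> x u \<in> Y}"
      by (rule cvec.subspaceI)
         (auto simp: rep Y_def cvec.span_zero cvec.span_add cvec.span_scale)
    then have "Y \<subseteq> {u. \<pi> x u \<in> Y}"
      unfolding Y_def using that(1) by (intro cvec.span_minimal) (auto simp: Y_def)
    then show ?thesis using that(2) by blast
  qed
  have up: "\<pi> (s n) v \<in> Y" if n: "1 \<le> n" and "v \<in> X" for n v
  proof -
    obtain J t where J: "v = word J t" "\<forall>i\<in>set J. 1 \<le> i" "t \<in> T" using \<open>v \<in> X\<close> by (auto simp: X_def)
    then have "\<pi> (s n) v \<in> X" using word_X[of "n # J" t] n by simp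
    then show ?thesis by (simp add: Y_def cvec.span_base)
  qed
  have down: "\<pi> ((s n)\<^sup>\<star>) v \<in> Y" if n: "1 \<le> n" and "v \<in> X" for n v
  proof -
    obtain J t where J: "v = word J t" "\<forall>i\<in>set J. 1 \<le> i" "t \<in> T" using \<open>v \<in> X\<close> by (auto simp: X_def)
    have "\<exists>i\<ge>1. \<exists>v'\<in>X. v = \<pi> (s i) v'"
    proof (cases J)
      case Nil
      then obtain i t' where "i \<ge> 1" "t' \<in> T" "v = \<pi> (s i) t'" using T[OF J(3)] J(1) by auto
      then show ?thesis using word_X[of "[]" t'] by auto
    next
      case (Cons i J')
      then show ?thesis using word_X[of J' t] J by (intro exI[of _ i]) auto
    qed
    then obtain i v' where "1 \<le> i" "v' \<in> X" "v = \<pi> (s i) v'" by blast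
    then show ?thesis
      using n by (auto simp: isometries Y_def cvec.span_base cvec.span_zero)
  qed
  have inv: "\<forall>u\<in>Y. \<pi> x u \<in> Y \<and> \<pi> (x\<^sup>\<star>) u \<in> Y" if "x \<in> star_subalgebra_gen s" for x
    using that
  proof (induction rule: star_subalgebra_gen.induct)
    case (sg_gen n)
    then show ?case using extend up down by blast
  qed (auto simp: rep star_add star_mult star_scaleC star_star Y_def cvec.span_add cvec.span_scale)
  have "\<Omega> \<in> Y" using word_X[of "[]" \<Omega>] \<Omega> by (simp add: Y_def cvec.span_base)
  then have gen_Y: "\<pi> x \<Omega> \<in> Y" if "x \<in> star_subalgebra_gen s" for x using inv that by blast
  have "\<pi> x \<Omega> \<in> closure Y" for x
  proof -
    have "x \<in> closure (star_subalgebra_gen s)" using gen by simp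
    then obtain f where f: "\<forall>n. f n \<in> star_subalgebra_gen s" "f \<longlonglongrightarrow> x"
      by (auto simp: closure_sequential)
    have "(\<lambda>n. \<pi> (f n) \<Omega>) \<longlonglongrightarrow> \<pi> x \<Omega>"
    proof (rule LIM_zero_cancel, rule Lim_null_comparison)
      show "\<forall>\<^sub>F n in sequentially. norm (\<pi> (f n) \<Omega> - \<pi> x \<Omega>) \<le> norm (f n - x) * norm \<Omega>"
      proof (intro always_eventually allI)
        fix n
        have "\<pi> (f n) \<Omega> - \<pi> x \<Omega> = \<pi> (f n - x) \<Omega>"
          using rep(1)[of "f n - x" x \<Omega>] by simp
        then show "norm (\<pi> (f n) \<Omega> - \<pi> x \<Omega>) \<le> norm (f n - x) * norm \<Omega>"
          using cstar_representation_contractive[OF representation] by metis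
      qed
      show "(\<lambda>n. norm (f n - x) * norm \<Omega>) \<longlonglongrightarrow> 0"
        using f(2) by (intro tendsto_mult_left_zero) (simp add: tendsto_norm_zero_iff LIM_zero_iff)
    qed
    moreover have "\<forall>n. \<pi> (f n) \<Omega> \<in> Y" using gen_Y f(1) by blast
    ultimately show ?thesis
      unfolding closure_sequential by (intro exI[of _ "\<lambda>n. \<pi> (f n) \<Omega>"] conjI)
  qed
  then have "range (\<lambda>x. \<pi> x \<Omega>) \<subseteq> closure Y" by blast
  then have "closure (range (\<lambda>x. \<pi> x \<Omega>)) \<subseteq> closure Y" by (intro closure_minimal) auto
  then show ?thesis using cyc unfolding cyclic_vector_def Y_def X_def by blast
qed

end

text \<open>Formally, \<open>tail N\<close> is the infinite product of the isometries with the indices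
  \<open>k i + 1\<close>, \<open>i \<ge> N\<close>.\<close>

locale cuntz_tail = cuntz_representation s \<pi>
  for s :: "nat \<Rightarrow> 'o::cstar_algebra" and \<pi> :: "'o \<Rightarrow> 'h::complex_hilbert_space \<Rightarrow> 'h" +
  fixes k :: "nat \<Rightarrow> nat" and tail :: "nat \<Rightarrow> 'h"
  assumes tail_step: "\<pi> (s (Suc (k N))) (tail (Suc N)) = tail N"
    and tail_nonzero: "tail 0 \<noteq> 0"
begin

text \<open>Every N from which on m agrees with k gives the same vector; the least one is a
  canonical choice.\<close>

definition occ_vec :: "(nat \<Rightarrow> nat) \<Rightarrow> 'h" where
  "occ_vec m = (let N = LEAST N. \<forall>i\<ge>N. m i = k i in occ_word N m (tail N))"

lemma occ_word_tail:
  assumes "\<forall>i\<ge>N. m i = k i" "N \<le> N'"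
  shows "occ_word N' m (tail N') = occ_word N m (tail N)"
  using assms(2) by (induction N' rule: dec_induct) (simp_all add: occ_word_Suc assms(1) tail_step)

lemma occ_vec_eq:
  assumes "\<forall>i\<ge>N. m i = k i"
  shows "occ_vec m = occ_word N m (tail N)"
  using occ_word_tail[OF LeastI[where P = "\<lambda>N. \<forall>i\<ge>N. m i = k i", OF assms]
      Least_le[where P = "\<lambda>N. \<forall>i\<ge>N. m i = k i", OF assms]]
  by (simp add: occ_vec_def Let_def)

lemma occ_vec_k: "occ_vec k = tail 0"
  using occ_vec_eq[of 0 k] by simp

lemma occ_word_eq_occ_vec:
  "occ_word N m (tail N) = occ_vec (\<lambda>i. if i < N then m i else k i)"
  by (subst occ_vec_eq[of N]) (auto intro: occ_word_cong)

lemma cinner_tail: "cinner (tail N) (tail N) = complex_of_real ((norm (tail 0))\<^sup>2)"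
proof (induction N)
  case 0
  show ?case by (rule cinner_self)
next
  case (Suc N)
  have "cinner (tail N) (tail N) = cinner (tail (Suc N)) (tail (Suc N))"
    by (subst (1 2) tail_step[symmetric]) (simp add: cinner_isometries)
  then show ?case using Suc by simp
qed

text \<open>Beyond a common N both vectors are words of equal length applied to the same tail. The
  first differing letter gives orthogonality, and equal words preserve the norm of the tail.\<close>

sublocale occupation_family k occ_vec "(norm (tail 0))\<^sup>2"
proof
  show "0 < (norm (tail 0))\<^sup>2" using tail_nonzero by simp
  fix m m' assume "m \<in> near k" "m' \<in> near k"
  then obtain N N' where "\<forall>i\<ge>N. m i = k i" "\<forall>i\<ge>N'. m' i = k i" by (auto simp: near_iff)
  then have N: "\<forall>i\<ge>max N N'. m i = k i" "\<forall>i\<ge>max N N'. m' i = k i" by auto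
  then have "(\<forall>i<max N N'. m i = m' i) \<longleftrightarrow> m = m'" by (auto simp: fun_eq_iff) (metis linorder_not_le max.bounded_iff)
  then show "cinner (occ_vec m) (occ_vec m')
      = (if m = m' then complex_of_real ((norm (tail 0))\<^sup>2) else 0)"
    by (simp only: occ_vec_eq[OF N(1)] occ_vec_eq[OF N(2)] cinner_occ_word cinner_tail)
qed

lemma word_in_dom:
  assumes "\<forall>i\<in>set J. 1 \<le> i"
  shows "word J (tail (length J)) \<in> dom"
  unfolding word_eq_occ_word[OF assms] occ_word_eq_occ_vec
  by (intro e_in_dom) (auto simp: near_iff intro!: exI[of _ "length J"])

end

text \<open>Two words of equal length are either orthogonal because a letter differs, or they
  preserve the inner product of the tails, which is 0.\<close>

lemma orthogonal_doms:
  assumes "cuntz_tail s \<pi> k tail" "cuntz_tail s \<pi> k' tail'"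
    and orth: "\<And>N. cinner (tail N) (tail' N) = 0"
    and "u \<in> occupation_family.dom k (cuntz_tail.occ_vec s \<pi> k tail)"
    and "v \<in> occupation_family.dom k' (cuntz_tail.occ_vec s \<pi> k' tail')"
  shows "cinner u v = 0"
proof -
  interpret A: cuntz_tail s \<pi> k tail by (rule assms(1))
  interpret B: cuntz_tail s \<pi> k' tail' by (rule assms(2))
  have e: "cinner (A.occ_vec m) (B.occ_vec m') = 0" if near: "m \<in> near k" "m' \<in> near k'" for m m'
  proof -
    obtain N N' where "\<forall>i\<ge>N. m i = k i" "\<forall>i\<ge>N'. m' i = k' i" using near by (auto simp: near_iff)
    then have N: "\<forall>i\<ge>max N N'. m i = k i" "\<forall>i\<ge>max N N'. m' i = k' i" by auto
    show ?thesis
      by (simp add: A.occ_vec_eq[OF N(1)] B.occ_vec_eq[OF N(2)] A.cinner_occ_word orth)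
  qed
  obtain f g where "f \<in> fock_domain k" "u = A.vec f" "g \<in> fock_domain k'" "v = B.vec g"
    using assms(4,5) by (auto simp: A.dom_def B.dom_def)
  then show ?thesis
    using e by (auto simp: A.vec_def B.vec_def cinner_sum_left cinner_sum_right
        cinner_scaleC_left cinner_scaleC_right fock_domain_def subset_iff intro!: sum.neutral)
qed

section \<open>The representations of the bosons\<close>

lemma eta_single_exists:
  fixes \<pi> :: "'o::cstar_algebra \<Rightarrow> 'h::complex_hilbert_space \<Rightarrow> 'h"
  assumes "cuntz_relations s" "closure (star_subalgebra_gen s) = UNIV"
    and "cstar_representation \<pi>" "cyclic_vector \<pi> \<Omega>" "1 \<le> j" "\<pi> (s j) \<Omega> = \<Omega>"
  shows "\<exists>D \<eta>. eta_single j \<Omega> D \<eta>"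
proof -
  have \<Omega>: "\<Omega> \<noteq> 0" using assms(4) by (simp add: cyclic_vector_def)
  \<comment> \<open>The letter j stands for j - 1 quanta, and the eigenvalue of annihilation after
    creation is one more, that is, j.\<close>
  interpret cuntz_tail s \<pi> "\<lambda>_. j - 1" "\<lambda>_. \<Omega>"
    using assms \<Omega> by unfold_locales simp_all
  have "{word J t | J t. (\<forall>i\<in>set J. 1 \<le> i) \<and> t \<in> {\<Omega>}} \<subseteq> dom"
    using word_in_dom by auto
  then have "cvec.span {word J t | J t. (\<forall>i\<in>set J. 1 \<le> i) \<and> t \<in> {\<Omega>}} \<subseteq> dom"
    using csubspace_dom by (intro cvec.span_minimal) (auto simp: csubspace_iff_subspace)
  then have "closure (cvec.span {word J t | J t. (\<forall>i\<in>set J. 1 \<le> i) \<and> t \<in> {\<Omega>}}) \<subseteq> closure dom"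
    by (rule closure_mono)
  moreover have "closure (cvec.span {word J t | J t. (\<forall>i\<in>set J. 1 \<le> i) \<and> t \<in> {\<Omega>}}) = UNIV"
  proof (rule words_dense[OF assms(2,4)])
    show "\<exists>i\<ge>1. \<exists>t'\<in>{\<Omega>}. t = \<pi> (s i) t'" if "t \<in> {\<Omega>}" for t
      using that assms(5,6) by (intro exI[of _ j]) auto
  qed simp
  ultimately have "closure dom = UNIV" by blast
  moreover have "act (ann n * (ann n)\<^sup>\<star>) \<Omega> = of_nat j *\<^sub>C \<Omega>" if "1 \<le> n" for n
    using act_antinumber[OF near_refl, of "n - 1"] that assms(5)
    unfolding occ_vec_k by simp
  ultimately show ?thesis
    using boson_action_act boson_cyclic_act unfolding eta_single_def occ_vec_k by blast
qed

text \<open>Since \<Omega> is \<open>\<pi> (s 1) \<Omega>'\<close> and \<Omega>' is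
  \<open>\<pi> (s 2) \<Omega>\<close>, both expand into infinite words with alternating letters 1
  and 2, and the tails alternate between the two vectors. The ranges of the two isometries are
  orthogonal.\<close>

lemma eta_pair_exists:
  fixes \<pi> :: "'o::cstar_algebra \<Rightarrow> 'h::complex_hilbert_space \<Rightarrow> 'h"
  assumes "cuntz_relations s" "closure (star_subalgebra_gen s) = UNIV"
    and "cstar_representation \<pi>" "cyclic_vector \<pi> \<Omega>" "\<pi> (s 1 * s 2) \<Omega> = \<Omega>"
  shows "\<exists>V1 V2 \<eta>12 \<eta>21. eta_pair \<Omega> (\<pi> (s 2) \<Omega>) V1 V2 \<eta>12 \<eta>21"
proof -
  define \<Omega>' where "\<Omega>' = \<pi> (s 2) \<Omega>"
  have \<Omega>: "\<Omega> \<noteq> 0" using assms(4) by (simp add: cyclic_vector_def)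
  interpret cuntz_representation s \<pi> using assms by unfold_locales
  have \<Omega>_eq: "\<Omega> = \<pi> (s 1) \<Omega>'" using assms(5) by (simp add: \<Omega>'_def rep)
  have \<Omega>': "\<Omega>' \<noteq> 0" using \<Omega> \<Omega>_eq by auto
  have orth: "cinner \<Omega> \<Omega>' = 0"
    unfolding \<Omega>'_def by (subst \<Omega>_eq) (simp add: cinner_isometries)
  then have orth': "cinner \<Omega>' \<Omega> = 0" using cinner_commute[of \<Omega>' \<Omega>] by simp
  \<comment> \<open>Positions start at 0, so an even n belongs to a generator with odd
    index.\<close>
  define k1 :: "nat \<Rightarrow> nat" where "k1 n = (if even n then 0 else 1)" for n
  define k2 :: "nat \<Rightarrow> nat" where "k2 n = (if even n then 1 else 0)" for n
  define t1 where "t1 n = (if even n then \<Omega> else \<Omega>')" for n :: nat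
  define t2 where "t2 n = (if even n then \<Omega>' else \<Omega>)" for n :: nat
  have two: "Suc (Suc 0) = 2" by simp
  interpret A: cuntz_tail s \<pi> k1 t1
    using \<Omega> by unfold_locales (auto simp: k1_def t1_def \<Omega>_eq[symmetric, simplified] \<Omega>'_def[symmetric] two)
  interpret B: cuntz_tail s \<pi> k2 t2
    using \<Omega>' by unfold_locales (auto simp: k2_def t2_def \<Omega>_eq[symmetric, simplified] \<Omega>'_def[symmetric] two)
  have Ak: "A.occ_vec k1 = \<Omega>" and Bk: "B.occ_vec k2 = \<Omega>'"
    by (simp_all add: A.occ_vec_k B.occ_vec_k t1_def t2_def)
  let ?W = "{u + v | u v. u \<in> A.dom \<and> v \<in> B.dom}"
  let ?X = "{word J t | J t. (\<forall>i\<in>set J. 1 \<le> i) \<and> t \<in> {\<Omega>, \<Omega>'}}"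
  have "closure ?W = UNIV"
  proof -
    have sub: "cvec.subspace A.dom" "cvec.subspace B.dom"
      using A.csubspace_dom B.csubspace_dom by (simp_all add: csubspace_iff_subspace)
    \<comment> \<open>For each length of J one family has the tail \<Omega> and the other \<Omega>';
      the parity decides which domain contains the word.\<close>
    have "word J t \<in> A.dom \<or> word J t \<in> B.dom" if "\<forall>i\<in>set J. 1 \<le> i" "t \<in> {\<Omega>, \<Omega>'}" for J t
      using A.word_in_dom[OF that(1)] B.word_in_dom[OF that(1)] that(2)
      by (auto simp: t1_def t2_def split: if_splits)
    then have "?X \<subseteq> A.dom \<union> B.dom" by blast
    also have "\<dots> \<subseteq> ?W"
      using cvec.subspace_0[OF sub(1)] cvec.subspace_0[OF sub(2)] by force
    finally have "cvec.span ?X \<subseteq> ?W"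
      by (rule cvec.span_minimal) (rule cvec.subspace_sums[OF sub])
    then have "closure (cvec.span ?X) \<subseteq> closure ?W" by (rule closure_mono)
    moreover have "closure (cvec.span ?X) = UNIV"
    proof (rule words_dense[OF assms(2,4)])
      have "\<exists>i\<ge>1. \<exists>t'\<in>{\<Omega>, \<Omega>'}. \<Omega> = \<pi> (s i) t'"
        by (intro exI[of _ 1] conjI bexI[of _ \<Omega>'] \<Omega>_eq) simp_all
      moreover have "\<exists>i\<ge>1. \<exists>t'\<in>{\<Omega>, \<Omega>'}. \<Omega>' = \<pi> (s i) t'"
        by (intro exI[of _ 2] conjI bexI[of _ \<Omega>] \<Omega>'_def) simp_all
      ultimately show "\<exists>i\<ge>1. \<exists>t'\<in>{\<Omega>, \<Omega>'}. t = \<pi> (s i) t'" if "t \<in> {\<Omega>, \<Omega>'}" for t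
        using that by blast
    qed simp
    ultimately show ?thesis by blast
  qed
  moreover have "cinner u v = 0" if "u \<in> A.dom" "v \<in> B.dom" for u v
    using orthogonal_doms[OF A.cuntz_tail_axioms B.cuntz_tail_axioms _ that] orth orth'
    by (auto simp: t1_def t2_def)
  moreover have "boson_cyclic A.dom A.act \<Omega>" "boson_cyclic B.dom B.act \<Omega>'"
    using A.boson_cyclic_act B.boson_cyclic_act unfolding Ak Bk .
  moreover have A_number: "A.act ((ann (Suc n))\<^sup>\<star> * ann (Suc n)) \<Omega> = of_nat (k1 n) *\<^sub>C \<Omega>"
    and B_number: "B.act ((ann (Suc n))\<^sup>\<star> * ann (Suc n)) \<Omega>' = of_nat (k2 n) *\<^sub>C \<Omega>'" for n
    using A.act_number[OF near_refl, of n] B.act_number[OF near_refl, of n] unfolding Ak Bk .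
  \<comment> \<open>\<open>act_ann\<close> treats nonzero entries only; annihilation at an entry 0
    is obtained from the number operator by \<open>an_eq_zero\<close>.\<close>
  interpret SA: occupation_state k1 A.dom A.act \<Omega>
    using A.boson_action_act calculation(3) \<Omega> A_number by unfold_locales
  interpret SB: occupation_state k2 B.dom B.act \<Omega>'
    using B.boson_action_act calculation(4) \<Omega>' B_number by unfold_locales
  have "A.act (ann (2 * n - 1)) \<Omega> = 0 \<and> B.act (ann (2 * n)) \<Omega>' = 0 \<and>
      A.act ((ann (2 * n))\<^sup>\<star> * ann (2 * n)) \<Omega> = \<Omega> \<and>
      B.act ((ann (2 * n - 1))\<^sup>\<star> * ann (2 * n - 1)) \<Omega>' = \<Omega>'" if n_pos: "1 \<le> n" for n
  proof -
    obtain p where n: "n = Suc p" using n_pos by (cases n) auto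
    have odd: "2 * n - 1 = Suc (2 * p)" and even: "2 * n = Suc (Suc (2 * p))" by (simp_all add: n)
    have "SA.an (2 * p) \<Omega> = 0"
      using SA.an_eq_zero[OF SA.omega_in_D, of "2 * p"] A_number[of "2 * p"]
      by (simp add: SA.eta_number[OF SA.omega_in_D] k1_def)
    moreover have "SB.an (Suc (2 * p)) \<Omega>' = 0"
      using SB.an_eq_zero[OF SB.omega_in_D, of "Suc (2 * p)"] B_number[of "Suc (2 * p)"]
      by (simp add: SB.eta_number[OF SB.omega_in_D] k2_def)
    ultimately show ?thesis
      unfolding odd even using A_number[of "Suc (2 * p)"] B_number[of "2 * p"]
      by (simp add: SA.an_def SB.an_def k1_def k2_def scaleC_one)
  qed
  ultimately have "eta_pair \<Omega> \<Omega>' A.dom B.dom A.act B.act"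
    unfolding eta_pair_def using A.boson_action_act B.boson_action_act by blast
  then show ?thesis unfolding \<Omega>'_def by blast
qed

section \<open>Occupation numbers of arbitrary representations with a given label\<close>

fun label_occupation :: "eta_label \<Rightarrow> nat \<Rightarrow> nat" where
  "label_occupation (Eta j) n = j - 1"
| "label_occupation Eta12 n = (if even n then 0 else 1)"
| "label_occupation Eta21 n = (if even n then 1 else 0)"

text \<open>Each sequence depends on the parity of its index only, so one even and one odd place
  beyond N decide. The bound j \<ge> 1 in \<open>eta_labels\<close> makes j - 1 determine j.\<close>

lemma labels_far:
  assumes "l \<in> eta_labels" "m \<in> eta_labels" "l \<noteq> m"
  shows "label_occupation l \<notin> near (label_occupation m)"
proof
  assume "label_occupation l \<in> near (label_occupation m)"
  then obtain N where "\<forall>i\<ge>N. label_occupation l i = label_occupation m i"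
    by (auto simp: near_iff)
  then have "label_occupation l (2 * N) = label_occupation m (2 * N)"
    "label_occupation l (Suc (2 * N)) = label_occupation m (Suc (2 * N))" by simp_all
  then show False using assms by (cases l; cases m) (auto simp: eta_labels_def)
qed

lemma number_of_antinumber:
  assumes "boson_action D \<eta>" "u \<in> D" "\<eta> (ann (Suc n) * (ann (Suc n))\<^sup>\<star>) u = of_nat (Suc p) *\<^sub>C u"
  shows "\<eta> ((ann (Suc n))\<^sup>\<star> * ann (Suc n)) u = of_nat p *\<^sub>C u"
proof -
  have "ann (Suc n) * (ann (Suc n))\<^sup>\<star> = (ann (Suc n))\<^sup>\<star> * ann (Suc n) + 1"
    using ann_ccr[of "Suc n" "Suc n"] by (simp add: algebra_simps)
  then have "of_nat (Suc p) *\<^sub>C u = \<eta> ((ann (Suc n))\<^sup>\<star> * ann (Suc n)) u + u"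
    using assms unfolding boson_action_def by metis
  then show ?thesis by (simp add: scaleC_add_left scaleC_one)
qed

lemma number_of_annihilated:
  assumes "boson_action D \<eta>" "u \<in> D" "\<eta> (ann n) u = 0"
  shows "\<eta> ((ann n)\<^sup>\<star> * ann n) u = 0"
proof -
  have scale: "\<eta> x (c *\<^sub>C u) = c *\<^sub>C \<eta> x u" for x c
    using assms(1,2) by (auto simp: boson_action_def adjointable_endos_def clinear_into_def)
  have "\<eta> ((ann n)\<^sup>\<star> * ann n) u = \<eta> ((ann n)\<^sup>\<star>) (0 *\<^sub>C u)"
    using assms by (simp add: boson_action_def)
  then show ?thesis unfolding scale by simp
qed

lemma eta_single_state:
  assumes "eta_single j \<Omega> D \<eta>" "1 \<le> j" "\<Omega> \<noteq> 0"
  shows "occupation_state (\<lambda>_. j - 1) D \<eta> \<Omega>"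
proof
  show act: "boson_action D \<eta>" and cyc: "boson_cyclic D \<eta> \<Omega>" and "\<Omega> \<noteq> 0"
    using assms by (auto simp: eta_single_def)
  have "\<Omega> \<in> D" using cyc by (simp add: boson_cyclic_def)
  moreover have "\<eta> (ann (Suc n) * (ann (Suc n))\<^sup>\<star>) \<Omega> = of_nat (Suc (j - 1)) *\<^sub>C \<Omega>" for n
    using assms(1,2) unfolding eta_single_def by simp
  ultimately show "\<eta> ((ann (Suc n))\<^sup>\<star> * ann (Suc n)) \<Omega> = of_nat (j - 1) *\<^sub>C \<Omega>" for n
    using number_of_antinumber[OF act] by blast
qed

lemma eta_pair_states:
  assumes "eta_pair \<Omega> \<Omega>' V1 V2 \<eta>12 \<eta>21" "\<Omega> \<noteq> 0" "\<Omega>' \<noteq> 0"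
  shows "occupation_state (label_occupation Eta12) V1 \<eta>12 \<Omega>"
    and "occupation_state (label_occupation Eta21) V2 \<eta>21 \<Omega>'"
proof -
  have act: "boson_action V1 \<eta>12" "boson_action V2 \<eta>21"
    and cyc: "boson_cyclic V1 \<eta>12 \<Omega>" "boson_cyclic V2 \<eta>21 \<Omega>'"
    and rel: "\<And>n. n \<ge> 1 \<Longrightarrow> \<eta>12 (ann (2 * n - 1)) \<Omega> = 0 \<and> \<eta>21 (ann (2 * n)) \<Omega>' = 0 \<and>
        \<eta>12 ((ann (2 * n))\<^sup>\<star> * ann (2 * n)) \<Omega> = \<Omega> \<and>
        \<eta>21 ((ann (2 * n - 1))\<^sup>\<star> * ann (2 * n - 1)) \<Omega>' = \<Omega>'"
    using assms(1) by (auto simp: eta_pair_def)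
  have mem: "\<Omega> \<in> V1" "\<Omega>' \<in> V2" using cyc by (simp_all add: boson_cyclic_def)
  have even: "\<eta>12 (ann (Suc (2 * p))) \<Omega> = 0"
      "\<eta>21 ((ann (Suc (2 * p)))\<^sup>\<star> * ann (Suc (2 * p))) \<Omega>' = \<Omega>'"
    and odd: "\<eta>21 (ann (Suc (Suc (2 * p)))) \<Omega>' = 0"
      "\<eta>12 ((ann (Suc (Suc (2 * p))))\<^sup>\<star> * ann (Suc (Suc (2 * p)))) \<Omega> = \<Omega>" for p
    using rel[of "Suc p"] by simp_all
  have "\<eta>12 ((ann (Suc n))\<^sup>\<star> * ann (Suc n)) \<Omega> = of_nat (label_occupation Eta12 n) *\<^sub>C \<Omega> \<and>
      \<eta>21 ((ann (Suc n))\<^sup>\<star> * ann (Suc n)) \<Omega>' = of_nat (label_occupation Eta21 n) *\<^sub>C \<Omega>'" for n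
  proof (cases "even n")
    case True
    then obtain p where "n = 2 * p" by blast
    then show ?thesis
      using even[of p] number_of_annihilated[OF act(1) mem(1)] by (simp add: scaleC_one)
  next
    case False
    then obtain p where "n = Suc (2 * p)" using oddE by fastforce
    then show ?thesis
      using odd[of p] number_of_annihilated[OF act(2) mem(2)] by (simp add: scaleC_one)
  qed
  then show "occupation_state (label_occupation Eta12) V1 \<eta>12 \<Omega>"
    "occupation_state (label_occupation Eta21) V2 \<eta>21 \<Omega>'"
    using act cyc assms(2,3) by (auto intro!: occupation_state.intro)
qed

text \<open>This reduces (iii) and (iv) to \<open>occupation_state\<close>. The second vacuum is
  nonzero because \<open>s 2\<close> acts isometrically.\<close>

lemma eta_representation_state:
  fixes s :: "nat \<Rightarrow> 'o::cstar_algebra" and D :: "'h::complex_hilbert_space set"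
  assumes "cuntz_relations s" "l \<in> eta_labels" "eta_representation s l D \<eta>"
  shows "\<exists>\<omega>. occupation_state (label_occupation l) D \<eta> \<omega>"
proof -
  have nonzero: "\<pi> (s 2) \<Omega> \<noteq> 0"
    if "cstar_representation \<pi>" "cyclic_vector \<pi> \<Omega>" for \<pi> :: "'o \<Rightarrow> 'h \<Rightarrow> 'h" and \<Omega>
  proof -
    interpret cuntz_representation s \<pi> using assms(1) that by unfold_locales
    show ?thesis
      using cinner_isometries[of 2 2 \<Omega> \<Omega>] that(2) by (auto simp: cyclic_vector_def)
  qed
  show ?thesis
  proof (cases l)
    case (Eta j)
    then have "1 \<le> j" using assms(2) by (auto simp: eta_labels_def)
    moreover obtain \<pi> :: "'o \<Rightarrow> 'h \<Rightarrow> 'h" and \<Omega> where "cyclic_vector \<pi> \<Omega>" "eta_single j \<Omega> D \<eta>"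
      using assms(3) Eta by auto
    moreover have "label_occupation l = (\<lambda>_. j - 1)" by (simp add: Eta fun_eq_iff)
    ultimately show ?thesis
      using eta_single_state[of j \<Omega> D \<eta>] by (auto simp: cyclic_vector_def)
  next
    case Eta12
    then obtain \<pi> :: "'o \<Rightarrow> 'h \<Rightarrow> 'h" and \<Omega> V2 \<eta>21
      where "cstar_representation \<pi>" "cyclic_vector \<pi> \<Omega>" "eta_pair \<Omega> (\<pi> (s 2) \<Omega>) D V2 \<eta> \<eta>21"
      using assms(3) by auto
    then show ?thesis
      using eta_pair_states(1) nonzero unfolding Eta12 cyclic_vector_def by blast
  next
    case Eta21
    then obtain \<pi> :: "'o \<Rightarrow> 'h \<Rightarrow> 'h" and \<Omega> V1 \<eta>12
      where "cstar_representation \<pi>" "cyclic_vector \<pi> \<Omega>" "eta_pair \<Omega> (\<pi> (s 2) \<Omega>) V1 D \<eta>12 \<eta>"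
      using assms(3) by auto
    then show ?thesis
      using eta_pair_states(2) nonzero unfolding Eta21 cyclic_vector_def by blast
  qed
qed

lemma eta_single_one_fock:
  assumes "eta_single 1 \<Omega> D \<eta>" "\<Omega> \<noteq> 0"
  shows "fock_representation D \<eta> \<Omega>"
proof -
  interpret occupation_state "\<lambda>_. 1 - 1" D \<eta> \<Omega>
    by (rule eta_single_state[OF assms(1) _ assms(2)]) simp
  have "\<eta> (ann n) \<Omega> = 0" if "1 \<le> n" for n
    using an_eq_zero[OF omega_in_D, of "n - 1"] monomial_number[OF monomial.base, of "n - 1"] that
    by (simp add: an_def)
  then show ?thesis using action cyclic by (simp add: fock_representation_def)
qed

theorem theorem1p5:
  fixes s :: "nat \<Rightarrow> 'o::cstar_algebra"
  assumes "cuntz_O_infinity s TYPE('c::cstar_algebra)"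
  shows
    "\<comment> \<open>(i)\<close>
     (\<forall>j\<ge>1. \<forall>(\<pi> :: 'o \<Rightarrow> 'h::complex_hilbert_space \<Rightarrow> 'h) \<Omega>.
        cstar_representation \<pi> \<and> cyclic_vector \<pi> \<Omega> \<and> \<pi> (s j) \<Omega> = \<Omega> \<longrightarrow>
          (\<exists>D \<eta>. eta_single j \<Omega> D \<eta>) \<and>
          (j = 1 \<longrightarrow> (\<forall>D \<eta>. eta_single 1 \<Omega> D \<eta> \<longrightarrow> fock_representation D \<eta> \<Omega>)))
     \<and> \<comment> \<open>(ii)\<close>
     (\<forall>(\<pi> :: 'o \<Rightarrow> 'h \<Rightarrow> 'h) \<Omega>.
        cstar_representation \<pi> \<and> cyclic_vector \<pi> \<Omega> \<and> \<pi> (s 1 * s 2) \<Omega> = \<Omega> \<longrightarrow>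
          (\<exists>V1 V2 \<eta>12 \<eta>21. eta_pair \<Omega> (\<pi> (s 2) \<Omega>) V1 V2 \<eta>12 \<eta>21))
     \<and> \<comment> \<open>(iii)\<close>
     (\<forall>l\<in>eta_labels. \<forall>m\<in>eta_labels. l \<noteq> m \<longrightarrow>
        (\<forall>(D :: 'h set) \<eta> (E :: 'k::complex_hilbert_space set) \<theta>.
           eta_representation s l D \<eta> \<and> eta_representation s m E \<theta> \<longrightarrow>
             \<not> boson_unitarily_equivalent D \<eta> E \<theta>))
     \<and> \<comment> \<open>(iv)\<close>
     (\<forall>l\<in>eta_labels. \<forall>(D :: 'h set) \<eta>. eta_representation s l D \<eta> \<longrightarrow> boson_irreducible D \<eta>)"
proof -
  have rel: "cuntz_relations s" and gen: "closure (star_subalgebra_gen s) = UNIV"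
    using assms by (auto simp: cuntz_O_infinity_def)
  show ?thesis
  proof (intro conjI allI impI ballI)
    fix j and \<pi> :: "'o \<Rightarrow> 'h \<Rightarrow> 'h" and \<Omega>
    assume j: "1 \<le> j" and \<pi>: "cstar_representation \<pi> \<and> cyclic_vector \<pi> \<Omega> \<and> \<pi> (s j) \<Omega> = \<Omega>"
    then show "\<exists>D \<eta>. eta_single j \<Omega> D \<eta>" using eta_single_exists[OF rel gen] by blast
    fix D \<eta> assume "eta_single 1 \<Omega> D \<eta>"
    then show "fock_representation D \<eta> \<Omega>"
      using \<pi> eta_single_one_fock by (auto simp: cyclic_vector_def)
  next
    fix \<pi> :: "'o \<Rightarrow> 'h \<Rightarrow> 'h" and \<Omega>
    assume "cstar_representation \<pi> \<and> cyclic_vector \<pi> \<Omega> \<and> \<pi> (s 1 * s 2) \<Omega> = \<Omega>"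
    then show "\<exists>V1 V2 \<eta>12 \<eta>21. eta_pair \<Omega> (\<pi> (s 2) \<Omega>) V1 V2 \<eta>12 \<eta>21"
      using eta_pair_exists[OF rel gen] by blast
  next
    fix l m and D :: "'h set" and \<eta> and E :: "'k set" and \<theta>
    assume lm: "l \<in> eta_labels" "m \<in> eta_labels" "l \<noteq> m"
      and "eta_representation s l D \<eta> \<and> eta_representation s m E \<theta>"
    then obtain \<omega> \<psi> where "occupation_state (label_occupation l) D \<eta> \<omega>"
      "occupation_state (label_occupation m) E \<theta> \<psi>"
      using eta_representation_state[OF rel lm(1)] eta_representation_state[OF rel lm(2)] by blast
    then show "\<not> boson_unitarily_equivalent D \<eta> E \<theta>"
      using equivalent_imp_near labels_far[OF lm] by blast
  next
    fix l and D :: "'h set" and \<eta>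
    assume "l \<in> eta_labels" "eta_representation s l D \<eta>"
    then show "boson_irreducible D \<eta>"
      using eta_representation_state[OF rel] occupation_state.irreducible by blast
  qed
qed

end
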